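(* Let $\Delta$ be a connected, pure $(d-1)$-dimensional simplicial complex with $d\ge5$ such that the link of every edge is a homology manifold without boundary. Then $$12h_4+6(d-4)h_3+(d-2)(d-7)h_2-(d-1)(d-2)h_1\ge0.$$
   Context: $h_i=\sum_{j=0}^i(-1)^{i-j}\binom{d-j}{d-i}f_{j-1}$, with $f_j$ the number of $j$-faces and $f_{-1}=1$. The link of a face $\rho$ is $\{\tau:\tau\cap\rho=\emptyset,\tau\cup\rho\in\Delta\}$. A homology manifold without boundary (over a field $k$) is a complex in which the link of every nonempty face has the $k$-homology of a sphere of dimension (complex dimension minus face dimension minus one).
   Formalization: The links of edges are additionally assumed connected; without this the claim fails, e.g. for two boundaries of the 5-simplex glued along an edge (d=5), where the left-hand side is -12. *)

theory Defs
  imports Complex_Main "HOL-Library.Function_Algebras"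
begin

section \<open>Finite abstract simplicial complexes\<close>

definition simplicial_complex :: "'a set set \<Rightarrow> bool" where
  "simplicial_complex \<Delta> \<longleftrightarrow>
     finite \<Delta> \<and> {} \<in> \<Delta> \<and> (\<forall>\<sigma>\<in>\<Delta>. finite \<sigma>) \<and> (\<forall>\<sigma>\<in>\<Delta>. \<forall>\<tau>. \<tau> \<subseteq> \<sigma> \<longrightarrow> \<tau> \<in> \<Delta>)"

text \<open>Dimensions are integers: the empty face and the complex \<open>{{}}\<close> have dimension \<open>-1\<close>.\<close>

definition face_dim :: "'a set \<Rightarrow> int" where
  "face_dim \<sigma> = int (card \<sigma>) - 1"

definition complex_dim :: "'a set set \<Rightarrow> int" where
  "complex_dim \<Delta> = Max (face_dim ` \<Delta>)"

definition pure_complex :: "'a set set \<Rightarrow> bool" where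
  "pure_complex \<Delta> \<longleftrightarrow>
     (\<forall>\<sigma>\<in>\<Delta>. (\<forall>\<tau>\<in>\<Delta>. \<sigma> \<subseteq> \<tau> \<longrightarrow> \<tau> = \<sigma>) \<longrightarrow> face_dim \<sigma> = complex_dim \<Delta>)"

definition connected_complex :: "'a set set \<Rightarrow> bool" where
  "connected_complex \<Delta> \<longleftrightarrow>
     (\<forall>u\<in>\<Union>\<Delta>. \<forall>v\<in>\<Union>\<Delta>. (u, v) \<in> {(x, y). {x, y} \<in> \<Delta>}\<^sup>*)"

definition link :: "'a set set \<Rightarrow> 'a set \<Rightarrow> 'a set set" where
  "link \<Delta> \<rho> = {\<tau>. \<tau> \<inter> \<rho> = {} \<and> \<tau> \<union> \<rho> \<in> \<Delta>}"

definition f_num :: "'a set set \<Rightarrow> int \<Rightarrow> nat" where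
  "f_num \<Delta> j = card {\<sigma>\<in>\<Delta>. face_dim \<sigma> = j}"

text \<open>Here \<open>d\<close> is \<open>complex_dim \<Delta> + 1\<close>, and \<open>i \<le> d\<close>.\<close>

definition h_num :: "nat \<Rightarrow> 'a set set \<Rightarrow> nat \<Rightarrow> int" where
  "h_num d \<Delta> i =
     (\<Sum>j=0..i. (-1) ^ (i - j) * int ((d - j) choose (d - i)) * int (f_num \<Delta> (int j - 1)))"


section \<open>Reduced simplicial homology with field coefficients\<close>

text \<open>
  An oriented \<open>i\<close>-chain assigns a coefficient to every ordering of the vertices of every
  \<open>i\<close>-face, and changes sign when two adjacent vertices are exchanged.  This needs no
  order on the vertices.  The only \<open>(-1)\<close>-simplex is the empty list, so the
  complex is the augmented one and its homology is reduced homology.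
\<close>

definition chains :: "'a set set \<Rightarrow> int \<Rightarrow> ('a list \<Rightarrow> 'k::field) set" where
  "chains \<Delta> i =
     {c. (\<forall>xs. c xs \<noteq> 0 \<longrightarrow> distinct xs \<and> set xs \<in> \<Delta> \<and> face_dim (set xs) = i) \<and>
         (\<forall>xs x y ys. c (xs @ x # y # ys) = - c (xs @ y # x # ys))}"

text \<open>
  In the boundary \<open>\<Sum>j. (-1)^j [v\<^sub>0, \<dots>, v\<^sub>j omitted, \<dots>, v\<^sub>p]\<close> of an
  oriented simplex, orient each coface of \<open>xs\<close> as \<open>v # xs\<close>; then \<open>xs\<close> occurs
  with sign \<open>+1\<close>.
\<close>

definition boundary :: "'a set set \<Rightarrow> ('a list \<Rightarrow> 'k::field) \<Rightarrow> 'a list \<Rightarrow> 'k" where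
  "boundary \<Delta> c = (\<lambda>xs. \<Sum>v\<in>\<Union>\<Delta>. c (v # xs))"

definition cycles :: "'a set set \<Rightarrow> int \<Rightarrow> ('a list \<Rightarrow> 'k::field) set" where
  "cycles \<Delta> i = {c \<in> chains \<Delta> i. boundary \<Delta> c = (\<lambda>_. 0)}"

definition boundaries :: "'a set set \<Rightarrow> int \<Rightarrow> ('a list \<Rightarrow> 'k::field) set" where
  "boundaries \<Delta> i = boundary \<Delta> ` chains \<Delta> (i + 1)"

lemma chains_supp:
  assumes "c \<in> chains \<Delta> i" "c xs \<noteq> 0"
  shows "distinct xs" "set xs \<in> \<Delta>" "face_dim (set xs) = i"
  using assms unfolding chains_def by blast+

lemma chains_swap:
  assumes "c \<in> chains \<Delta> i"
  shows "c (xs @ x # y # ys) = - c (xs @ y # x # ys)"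
  using assms unfolding chains_def by blast

lemma boundary_in_chains:
  assumes "simplicial_complex \<Delta>" and c: "c \<in> chains \<Delta> (i + 1)"
  shows "boundary \<Delta> c \<in> chains \<Delta> i"
proof -
  have "distinct xs \<and> set xs \<in> \<Delta> \<and> face_dim (set xs) = i"
    if nz: "boundary \<Delta> c xs \<noteq> 0" for xs
  proof -
    obtain v where "c (v # xs) \<noteq> 0"
      using nz by (auto simp: boundary_def elim: sum.not_neutral_contains_not_neutral)
    note v = chains_supp[OF c this]
    have "set xs \<in> \<Delta>"
      using v(2) assms(1) set_subset_Cons[of xs v] unfolding simplicial_complex_def by blast
    then show ?thesis using v(1,3) by (simp add: face_dim_def)
  qed
  moreover have "boundary \<Delta> c (xs @ x # y # ys) = - boundary \<Delta> c (xs @ y # x # ys)"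
    for xs x y ys
  proof -
    have "c (v # xs @ x # y # ys) = - c (v # xs @ y # x # ys)" for v
      using chains_swap[OF c, of "v # xs" x y ys] by (simp only: append_Cons)
    then show ?thesis
      unfolding boundary_def sum_negf[symmetric] by (rule sum.cong[OF refl])
  qed
  ultimately show ?thesis unfolding chains_def by blast
qed

lemma boundary_boundary:
  assumes "simplicial_complex \<Delta>" and c: "c \<in> chains \<Delta> i"
  shows "boundary \<Delta> (boundary \<Delta> c) = (\<lambda>_. 0)"
proof
  fix xs
  have anti: "c (v # w # xs) = - c (w # v # xs)" for v w
    using chains_swap[OF c, of "[]"] by (metis append_Nil)
  have diag: "c (v # v # xs) = 0" for v
    using chains_supp(1)[OF c, of "v # v # xs"] by fastforce
  have "finite (\<Union>\<Delta>)" using assms(1) unfolding simplicial_complex_def by blast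
  then have "(\<Sum>v\<in>\<Union>\<Delta>. \<Sum>w\<in>\<Union>\<Delta>. c (w # v # xs)) = 0"
  proof (induction rule: finite_induct)
    case (insert a V)
    have "(\<Sum>v\<in>V. c (a # v # xs)) = - (\<Sum>v\<in>V. c (v # a # xs))"
      unfolding sum_negf[symmetric] by (rule sum.cong[OF refl]) (rule anti)
    then show ?case using insert by (simp add: sum.distrib diag)
  qed simp
  then show "boundary \<Delta> (boundary \<Delta> c) xs = 0" by (simp add: boundary_def)
qed

lemma boundaries_subset_cycles:
  assumes "simplicial_complex \<Delta>"
  shows "(boundaries \<Delta> i :: ('a list \<Rightarrow> 'k::field) set) \<subseteq> cycles \<Delta> i"
  using boundary_in_chains[OF assms] boundary_boundary[OF assms]
  unfolding boundaries_def cycles_def by blast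

interpretation chain_space: vector_space "\<lambda>(a::'k::field) (c :: 'a list \<Rightarrow> 'k) xs. a * c xs"
  by unfold_locales (auto simp: fun_eq_iff algebra_simps)

text \<open>
  The dimension over \<open>'k\<close> of reduced homology, cycles modulo boundaries; by
  \<open>boundaries_subset_cycles\<close> the subtraction does not truncate.
\<close>

definition reduced_betti :: "'k::field itself \<Rightarrow> 'a set set \<Rightarrow> int \<Rightarrow> nat" where
  "reduced_betti _ \<Delta> i =
     chain_space.dim (cycles \<Delta> i :: ('a list \<Rightarrow> 'k) set) -
     chain_space.dim (boundaries \<Delta> i :: ('a list \<Rightarrow> 'k) set)"

text \<open>The \<open>(-1)\<close>-sphere is the empty space, whose only reduced homology is in degree \<open>-1\<close>.\<close>

definition has_homology_of_sphere :: "'k::field itself \<Rightarrow> 'a set set \<Rightarrow> int \<Rightarrow> bool" where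
  "has_homology_of_sphere K \<Delta> n \<longleftrightarrow>
     (\<forall>i. reduced_betti K \<Delta> i = (if i = n then 1 else 0))"

definition homology_manifold :: "'k::field itself \<Rightarrow> 'a set set \<Rightarrow> bool" where
  "homology_manifold K \<Delta> \<longleftrightarrow> simplicial_complex \<Delta> \<and>
     (\<forall>\<tau>\<in>\<Delta>. \<tau> \<noteq> {} \<longrightarrow>
        has_homology_of_sphere K (link \<Delta> \<tau>) (complex_dim \<Delta> - face_dim \<tau> - 1))"

text \<open>
  Manifolds are without boundary here.  As the condition concerns nonempty faces only,
  it does not force connectedness.  The inequality for \<open>h\<close>-numbers needs connected
  links of edges, the usual convention for manifolds: two copies of the boundary of the
  5-simplex glued along one edge form a connected, pure 4-dimensional complex whose edge
  links are one tetrahedron boundary or, at the common edge, two disjoint ones, and there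
  the left-hand side equals \<open>-12\<close>.
\<close>

end

(*
  Double counting turns the left-hand side into 2 * (\<Sum>e. h_2(lk e) - h_1(lk e)), summed over the
  edges e, so it suffices to prove the lower bound theorem f_1 \<ge> D f_0 - binom(D + 1, 2) for the
  edge links, where D = d - 2 \<ge> 3.  Reduced homology in degree 0 alone shows that they are normal
  pseudomanifolds: links of faces of codimension at least 2 are connected, and those of ridges
  consist of two points.

  For normal pseudomanifolds the bound is proved by Gromov's combinatorial rigidity (see Bagchi and
  Datta, "Lower bound theorem for normal pseudomanifolds"): if a vertex set A avoids a facet, at
  least D * card A edges meet A.  This property passes from a link to its cone with D replaced by
  D + 1, and to unions of complexes that share a facet, hence from the vertex links to the whole
  complex.  The base case D = 3 is a count of edges and triangles in a closed surface.
*)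
theory Submission
  imports Defs
begin

section \<open>Normal pseudomanifolds\<close>

text \<open>For a link whose facets have \<open>D\<close> vertices,
  \<open>h_2 - h_1 = f_1 - D f_0 + binom(D + 1, 2)\<close>, so nonnegativity of each summand is
  exactly the lower bound. That bound uses rigidity only for complements of facets, but gluing
  splits \<open>A\<close> into two pieces that need not be such complements; the statement for all
  \<open>A\<close> avoiding a facet is the one that an induction can carry. The induction cannot
  start below \<open>D = 3\<close>: an \<open>n\<close>-gon with \<open>n > 3\<close> has fewer than
  \<open>2 n - 3\<close> edges. This matches \<open>d \<ge> 5\<close>. The obstacle is therefore the
  surface case. Genus and orientability are arbitrary, so no fixed Euler characteristic can be used.
  A parity argument takes its place: the mod 2 boundary of a set of triangles has even degree at
  every vertex, whereas every nonempty part of a forest has a leaf. Hence a forest contains no full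
  cut of the dual graph.\<close>

definition cut_connected :: "'a set set \<Rightarrow> bool" where
  "cut_connected X \<longleftrightarrow>
     (\<forall>S. S \<subseteq> \<Union>X \<longrightarrow> S \<noteq> {} \<longrightarrow> S \<noteq> \<Union>X \<longrightarrow> (\<exists>x\<in>S. \<exists>y\<in>\<Union>X - S. {x, y} \<in> X))"

text \<open>\<open>D\<close> is the number of vertices of a facet, so the dimension is
  \<open>D - 1\<close>. The face \<open>{}\<close> is included: for \<open>2 \<le> D\<close> it
  gives connectedness of \<open>X\<close> itself. Connectedness is phrased by cuts because each use
  either enlarges a vertex set by one neighbour or shows that a set closed under adjacency is
  everything.\<close>

definition normal_pseudomanifold :: "nat \<Rightarrow> 'a set set \<Rightarrow> bool" where
  "normal_pseudomanifold D X \<longleftrightarrow> simplicial_complex X \<and>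
     (\<forall>\<sigma>\<in>X. card \<sigma> \<le> D \<and> (\<exists>\<tau>\<in>X. \<sigma> \<subseteq> \<tau> \<and> card \<tau> = D)) \<and>
     (\<forall>\<sigma>\<in>X. card \<sigma> + 2 \<le> D \<longrightarrow> cut_connected (link X \<sigma>)) \<and>
     (\<forall>\<sigma>\<in>X. card \<sigma> + 1 = D \<longrightarrow> card (\<Union>(link X \<sigma>)) = 2)"

definition edges :: "'a set set \<Rightarrow> 'a set set" where
  "edges X = {e\<in>X. card e = 2}"

definition edges_meeting :: "'a set set \<Rightarrow> 'a set \<Rightarrow> 'a set set" where
  "edges_meeting X A = {e\<in>edges X. e \<inter> A \<noteq> {}}"

lemma simplicial_complexD:
  assumes "simplicial_complex X"
  shows "finite X" "{} \<in> X" "\<sigma> \<in> X \<Longrightarrow> finite \<sigma>" "\<sigma> \<in> X \<Longrightarrow> \<tau> \<subseteq> \<sigma> \<Longrightarrow> \<tau> \<in> X" "finite (\<Union>X)"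
  using assms unfolding simplicial_complex_def by blast+

lemma link_empty [simp]: "link X {} = X"
  by (simp add: link_def)

lemma link_link: "\<tau> \<in> link X \<sigma> \<Longrightarrow> link (link X \<sigma>) \<tau> = link X (\<sigma> \<union> \<tau>)"
  unfolding link_def by (auto simp: Int_Un_distrib Int_Un_distrib2 Un_ac)

lemma simplicial_complex_link:
  assumes "simplicial_complex X" "\<sigma> \<in> X"
  shows "simplicial_complex (link X \<sigma>)"
proof -
  note X = simplicial_complexD[OF assms(1)]
  have "link X \<sigma> \<subseteq> X" using X(4) unfolding link_def by blast
  moreover have "{} \<in> link X \<sigma>" using assms(2) by (simp add: link_def)
  moreover have "\<tau> \<in> link X \<sigma>" if "\<rho> \<in> link X \<sigma>" "\<tau> \<subseteq> \<rho>" for \<rho> \<tau>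
    using that X(4)[of "\<rho> \<union> \<sigma>" "\<tau> \<union> \<sigma>"] unfolding link_def by blast
  ultimately show ?thesis
    using X(1,3) finite_subset[of "link X \<sigma>" X] unfolding simplicial_complex_def by blast
qed

lemma in_Union_link:
  assumes "simplicial_complex X"
  shows "v \<in> \<Union>(link X \<sigma>) \<longleftrightarrow> v \<notin> \<sigma> \<and> insert v \<sigma> \<in> X"
proof
  assume "v \<in> \<Union>(link X \<sigma>)"
  then obtain \<tau> where "v \<in> \<tau>" "\<tau> \<inter> \<sigma> = {}" "\<tau> \<union> \<sigma> \<in> X" by (auto simp: link_def)
  moreover from this have "insert v \<sigma> \<subseteq> \<tau> \<union> \<sigma>" by blast
  ultimately show "v \<notin> \<sigma> \<and> insert v \<sigma> \<in> X" using simplicial_complexD(4)[OF assms] by blast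
next
  assume "v \<notin> \<sigma> \<and> insert v \<sigma> \<in> X"
  then have "{v} \<in> link X \<sigma>" by (simp add: link_def)
  then show "v \<in> \<Union>(link X \<sigma>)" by blast
qed

lemma vertex_in_complex:
  assumes "simplicial_complex X" "v \<in> \<Union>X" shows "{v} \<in> X"
  using assms simplicial_complexD(4)[OF assms(1)] by blast

lemma card_link_face:
  assumes "simplicial_complex X" "\<sigma> \<in> X" "\<tau> \<in> link X \<sigma>"
  shows "card (\<sigma> \<union> \<tau>) = card \<sigma> + card \<tau>" "\<sigma> \<union> \<tau> \<in> X"
proof -
  show "\<sigma> \<union> \<tau> \<in> X" using assms(3) by (simp add: link_def Un_commute)
  then have "finite (\<sigma> \<union> \<tau>)" using simplicial_complexD(3)[OF assms(1)] by blast
  then show "card (\<sigma> \<union> \<tau>) = card \<sigma> + card \<tau>"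
    using assms(3) by (intro card_Un_disjoint) (auto simp: link_def)
qed

lemma pure_link:
  assumes "simplicial_complex X" "\<And>\<rho>. \<rho> \<in> X \<Longrightarrow> card \<rho> \<le> D \<and> (\<exists>\<tau>\<in>X. \<rho> \<subseteq> \<tau> \<and> card \<tau> = D)"
    and "\<sigma> \<in> X" "\<tau> \<in> link X \<sigma>"
  shows "card \<tau> \<le> D - card \<sigma> \<and> (\<exists>\<rho>\<in>link X \<sigma>. \<tau> \<subseteq> \<rho> \<and> card \<rho> = D - card \<sigma>)"
proof -
  note c = card_link_face[OF assms(1,3,4)]
  obtain \<rho> where \<rho>: "\<rho> \<in> X" "\<sigma> \<union> \<tau> \<subseteq> \<rho>" "card \<rho> = D" using assms(2) c(2) by blast
  have "\<rho> - \<sigma> \<in> link X \<sigma>" using \<rho> by (auto simp: link_def Un_absorb2)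
  moreover have "card (\<rho> - \<sigma>) = D - card \<sigma>"
    using \<rho> simplicial_complexD(3)[OF assms(1), of \<sigma>] assms(3) by (simp add: card_Diff_subset)
  moreover have "\<tau> \<subseteq> \<rho> - \<sigma>" using \<rho>(2) assms(4) by (auto simp: link_def)
  ultimately show ?thesis using c assms(2)[OF c(2)] by (metis add_le_imp_le_diff add.commute)
qed

text \<open>By \<open>link_link\<close> a link inside \<open>link X \<sigma>\<close> is the link of
  a larger face of \<open>X\<close>, so each clause is inherited with cardinalities shifted by
  \<open>card \<sigma>\<close>.\<close>

lemma normal_pseudomanifold_link:
  assumes X: "normal_pseudomanifold D X" and \<sigma>: "\<sigma> \<in> X"
  shows "normal_pseudomanifold (D - card \<sigma>) (link X \<sigma>)"
proof -
  have sc: "simplicial_complex X" using X by (simp add: normal_pseudomanifold_def)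
  have conn: "cut_connected (link (link X \<sigma>) \<tau>)"
    if "\<tau> \<in> link X \<sigma>" "card \<tau> + 2 \<le> D - card \<sigma>" for \<tau>
    using X that card_link_face[OF sc \<sigma> that(1)]
    unfolding normal_pseudomanifold_def link_link[OF that(1)] by simp
  have two: "card (\<Union>(link (link X \<sigma>) \<tau>)) = 2"
    if "\<tau> \<in> link X \<sigma>" "card \<tau> + 1 = D - card \<sigma>" for \<tau>
    using X that card_link_face[OF sc \<sigma> that(1)]
    unfolding normal_pseudomanifold_def link_link[OF that(1)] by simp
  have "card \<tau> \<le> D - card \<sigma> \<and> (\<exists>\<rho>\<in>link X \<sigma>. \<tau> \<subseteq> \<rho> \<and> card \<rho> = D - card \<sigma>)"
    if "\<tau> \<in> link X \<sigma>" for \<tau>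
    using pure_link[OF sc _ \<sigma> that] X by (simp add: normal_pseudomanifold_def)
  then show ?thesis
    unfolding normal_pseudomanifold_def[of "D - card \<sigma>"]
    using simplicial_complex_link[OF sc \<sigma>] conn two by blast
qed

section \<open>Gromov's combinatorial rigidity\<close>

text \<open>A restriction on \<open>A\<close> is unavoidable: with \<open>A\<close> the set of all
  vertices, the boundary of a \<open>D\<close>-simplex would need \<open>D * (D + 1)\<close> edges
  and has half as many.\<close>

definition gromov_rigid :: "nat \<Rightarrow> 'a set set \<Rightarrow> bool" where
  "gromov_rigid D X \<longleftrightarrow>
     (\<forall>A\<subseteq>\<Union>X. (\<exists>\<sigma>\<in>X. card \<sigma> = D \<and> \<sigma> \<inter> A = {}) \<longrightarrow> D * card A \<le> card (edges_meeting X A))"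

text \<open>The vertices of \<open>A\<close> in \<open>X\<close> are charged to \<open>X\<close>,
  where \<open>\<rho>\<close> avoids them; the others to \<open>Y\<close>, where the shared facet
  \<open>\<sigma>\<close> avoids them because its vertices lie in \<open>X\<close>. No edge is
  counted twice, as an edge of the second kind has a vertex outside \<open>X\<close>.\<close>

lemma gromov_rigid_Un_aux:
  assumes fin: "finite (\<Union>X)" "finite X" "finite (\<Union>Y)" "finite Y"
    and X: "gromov_rigid D X" and Y: "gromov_rigid D Y"
    and \<sigma>: "\<sigma> \<in> X" "\<sigma> \<in> Y" "card \<sigma> = D"
    and A: "A \<subseteq> \<Union>(X \<union> Y)" and \<rho>: "\<rho> \<in> X" "card \<rho> = D" "\<rho> \<inter> A = {}"
  shows "D * card A \<le> card (edges_meeting (X \<union> Y) A)"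
proof -
  let ?A1 = "A \<inter> \<Union>X" and ?A2 = "A - \<Union>X"
  have "D * card ?A1 \<le> card (edges_meeting X ?A1)"
    using X \<rho> unfolding gromov_rigid_def by blast
  moreover have "D * card ?A2 \<le> card (edges_meeting Y ?A2)"
  proof -
    have "?A2 \<subseteq> \<Union>Y" "\<sigma> \<inter> ?A2 = {}" using A \<sigma> by blast+
    then show ?thesis using Y \<sigma> unfolding gromov_rigid_def by blast
  qed
  moreover have "card (edges_meeting X ?A1) + card (edges_meeting Y ?A2)
      \<le> card (edges_meeting (X \<union> Y) A)"
  proof -
    have "edges_meeting X ?A1 \<inter> edges_meeting Y ?A2 = {}"
      by (auto simp: edges_meeting_def edges_def)
    then have "card (edges_meeting X ?A1) + card (edges_meeting Y ?A2)
        = card (edges_meeting X ?A1 \<union> edges_meeting Y ?A2)"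
      using fin by (intro card_Un_disjoint[symmetric]) (auto simp: edges_meeting_def edges_def)
    also have "\<dots> \<le> card (edges_meeting (X \<union> Y) A)"
      using fin by (intro card_mono) (auto simp: edges_meeting_def edges_def)
    finally show ?thesis .
  qed
  moreover have "card A = card ?A1 + card ?A2"
  proof -
    have "finite A" using A fin finite_subset[of A "\<Union>X \<union> \<Union>Y"] by auto
    then show ?thesis using card_Int_Diff[of A "\<Union>X"] by simp
  qed
  ultimately show ?thesis by (simp add: distrib_left)
qed

lemma gromov_rigid_Un:
  assumes "finite (\<Union>X)" "finite X" "finite (\<Union>Y)" "finite Y"
    and "gromov_rigid D X" "gromov_rigid D Y"
    and "\<sigma> \<in> X" "\<sigma> \<in> Y" "card \<sigma> = D"
  shows "gromov_rigid D (X \<union> Y)"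
proof -
  have "D * card A \<le> card (edges_meeting (X \<union> Y) A)"
    if "A \<subseteq> \<Union>(X \<union> Y)" "\<rho> \<in> X \<union> Y" "card \<rho> = D" "\<rho> \<inter> A = {}" for A \<rho>
  proof (cases "\<rho> \<in> X")
    case True
    show ?thesis using gromov_rigid_Un_aux[OF assms that(1) True that(3,4)] .
  next
    case False
    then have "\<rho> \<in> Y" using that(2) by blast
    from gromov_rigid_Un_aux[OF assms(3,4,1,2,6,5,8,7,9) _ this that(3,4)] that(1)
    show ?thesis by (simp add: Un_commute)
  qed
  then show ?thesis unfolding gromov_rigid_def by blast
qed

text \<open>The closed star, that is, the cone with apex \<open>v\<close> over the link of
  \<open>v\<close>.\<close>

definition star :: "'a set set \<Rightarrow> 'a \<Rightarrow> 'a set set" where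
  "star X v = {\<tau>. insert v \<tau> \<in> X}"

lemma star_subset: "simplicial_complex X \<Longrightarrow> star X v \<subseteq> X"
  unfolding star_def simplicial_complex_def by blast

text \<open>A facet of the cone contains the apex, since adding \<open>v\<close> would otherwise
  exceed the dimension. So \<open>A\<close> misses \<open>v\<close> and lies in the link; the link
  supplies \<open>D * card A\<close> edges and the spokes \<open>{a, v}\<close> supply
  \<open>card A\<close> more.\<close>

lemma gromov_rigid_star:
  assumes sc: "simplicial_complex X" and D: "\<And>\<tau>. \<tau> \<in> X \<Longrightarrow> card \<tau> \<le> Suc D"
    and lk: "gromov_rigid D (link X {v})"
  shows "gromov_rigid (Suc D) (star X v)"
  unfolding gromov_rigid_def
proof (intro allI impI, elim bexE conjE)
  fix A \<sigma> assume A: "A \<subseteq> \<Union>(star X v)" and \<sigma>: "\<sigma> \<in> star X v" "card \<sigma> = Suc D" "\<sigma> \<inter> A = {}"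
  note X = simplicial_complexD[OF sc]
  have fins: "finite \<sigma>" using \<sigma>(2) card.infinite by fastforce
  have v: "v \<in> \<sigma>"
  proof (rule ccontr)
    assume "v \<notin> \<sigma>"
    then have "card (insert v \<sigma>) = Suc (Suc D)" using fins \<sigma>(2) by simp
    moreover have "insert v \<sigma> \<in> X" using \<sigma>(1) by (simp add: star_def)
    ultimately show False using D by fastforce
  qed
  have vA: "v \<notin> A" using v \<sigma>(3) by blast
  have e: "a \<noteq> v \<and> {a, v} \<in> X" if "a \<in> A" for a
  proof -
    have "a \<in> \<Union>(star X v)" using A that by (rule subsetD)
    then obtain \<tau> where "a \<in> \<tau>" "insert v \<tau> \<in> X" unfolding star_def by blast
    then have "{a, v} \<in> X" using X(4)[of "insert v \<tau>" "{a, v}"] by blast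
    then show ?thesis using vA that by blast
  qed
  have AL: "A \<subseteq> \<Union>(link X {v})" 
    using e in_Union_link[OF sc, of _ "{v}"] by (simp add: subset_iff)
  have finA: "finite A" using finite_subset[OF A] X(5) star_subset[OF sc, of v]
    by (meson Union_mono finite_subset)
  have "\<sigma> - {v} \<in> link X {v}" using \<sigma>(1) v by (auto simp: link_def star_def insert_absorb)
  moreover have "card (\<sigma> - {v}) = D" using \<sigma>(2) v fins by simp
  moreover have "(\<sigma> - {v}) \<inter> A = {}" using \<sigma>(3) by blast
  ultimately have "D * card A \<le> card (edges_meeting (link X {v}) A)"
    using lk AL unfolding gromov_rigid_def by blast
  moreover have "card ((\<lambda>a. {a, v}) ` A) = card A"
    using vA by (intro card_image) (auto simp: inj_on_def doubleton_eq_iff)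
  moreover have "card (edges_meeting (link X {v}) A) + card ((\<lambda>a. {a, v}) ` A)
      = card (edges_meeting (link X {v}) A \<union> (\<lambda>a. {a, v}) ` A)"
  proof (rule card_Un_disjoint[symmetric])
    have "link X {v} \<subseteq> X" using X(4) unfolding link_def by blast
    then show "finite (edges_meeting (link X {v}) A)"
      using X(1) by (auto simp: edges_meeting_def edges_def intro: finite_subset)
  qed (use finA in \<open>auto simp: edges_meeting_def edges_def link_def\<close>)
  moreover have "\<dots> \<le> card (edges_meeting (star X v) A)"
  proof (rule card_mono)
    show "finite (edges_meeting (star X v) A)"
      using X(1) star_subset[OF sc, of v]
      by (auto simp: edges_meeting_def edges_def intro: finite_subset)
    show "edges_meeting (link X {v}) A \<union> (\<lambda>a. {a, v}) ` A \<subseteq> edges_meeting (star X v) A"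
    proof
      fix \<epsilon> assume "\<epsilon> \<in> edges_meeting (link X {v}) A \<union> (\<lambda>a. {a, v}) ` A"
      then consider "\<epsilon> \<in> edges_meeting (link X {v}) A" | a where "a \<in> A" "\<epsilon> = {a, v}" by blast
      then show "\<epsilon> \<in> edges_meeting (star X v) A"
      proof cases
        case 1
        then show ?thesis by (simp add: edges_meeting_def edges_def link_def star_def)
      next
        case 2
        then show ?thesis
          using e[of a] by (simp add: edges_meeting_def edges_def star_def insert_commute)
      qed
    qed
  qed
  ultimately show "Suc D * card A \<le> card (edges_meeting (star X v) A)" by simp
qed

text \<open>Vertex stars are glued one at a time. If the new vertex \<open>y\<close> is adjacent to
  a treated vertex \<open>x\<close>, a facet through \<open>{x, y}\<close> lies in both stars, which
  is what gluing requires.\<close>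

lemma gromov_rigid_of_links:
  assumes sc: "simplicial_complex X"
    and pure: "\<And>\<sigma>. \<sigma> \<in> X \<Longrightarrow> card \<sigma> \<le> Suc D \<and> (\<exists>\<tau>\<in>X. \<sigma> \<subseteq> \<tau> \<and> card \<tau> = Suc D)"
    and conn: "cut_connected X"
    and lk: "\<And>v. v \<in> \<Union>X \<Longrightarrow> gromov_rigid D (link X {v})"
  shows "gromov_rigid (Suc D) X"
proof -
  note X = simplicial_complexD[OF sc]
  have fin: "finite (\<Union>Y)" "finite Y" if "Y \<subseteq> X" for Y
    using X(1,5) that by (auto intro: finite_subset)
  have st: "gromov_rigid (Suc D) (star X v)" if "v \<in> \<Union>X" for v
    using gromov_rigid_star[OF sc _ lk[OF that]] pure by blast
  obtain v0 where v0: "v0 \<in> \<Union>X"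
  proof -
    obtain \<tau> where "\<tau> \<in> X" "card \<tau> = Suc D" using pure[OF X(2)] by blast
    then have "\<tau> \<noteq> {}" by auto
    then show ?thesis using that \<open>\<tau> \<in> X\<close> by blast
  qed
  \<comment> \<open>The induction starts at a single star: an empty union has no facet to glue
    along.\<close>
  have ex: "\<exists>U\<subseteq>\<Union>X. card U = n \<and> gromov_rigid (Suc D) (\<Union>v\<in>U. star X v)"
    if "1 \<le> n" "n \<le> card (\<Union>X)" for n
    using that
  proof (induction n rule: dec_induct)
    case base
    show ?case using v0 st by (intro exI[of _ "{v0}"]) simp
  next
    case (step n)
    then obtain U where U: "U \<subseteq> \<Union>X" "card U = n" "gromov_rigid (Suc D) (\<Union>v\<in>U. star X v)" by auto
    have "U \<noteq> {}" "U \<noteq> \<Union>X" using U(2) step by auto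
    then obtain x y where xy: "x \<in> U" "y \<in> \<Union>X - U" "{x, y} \<in> X"
      using conn U(1) unfolding cut_connected_def by meson
    obtain \<sigma> where \<sigma>: "\<sigma> \<in> X" "{x, y} \<subseteq> \<sigma>" "card \<sigma> = Suc D" using pure[OF xy(3)] by blast
    have s: "(\<Union>v\<in>U. star X v) \<subseteq> X" "star X y \<subseteq> X" using star_subset[OF sc] by blast+
    have "gromov_rigid (Suc D) ((\<Union>v\<in>U. star X v) \<union> star X y)"
    proof (rule gromov_rigid_Un[OF fin[OF s(1)] fin[OF s(2)] U(3) st _ _ \<sigma>(3)])
      show "\<sigma> \<in> (\<Union>v\<in>U. star X v)" "\<sigma> \<in> star X y"
        using \<sigma>(1,2) xy(1) by (auto simp: star_def insert_absorb intro!: bexI[of _ x])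
    qed (use xy in blast)
    moreover have "card (insert y U) = Suc n"
      using U xy finite_subset[OF U(1) X(5)] by simp
    ultimately show ?case using U(1) xy(2) by (intro exI[of _ "insert y U"]) (simp add: Un_commute)
  qed
  have "card (\<Union>X) \<ge> 1" using v0 X(5) by (metis One_nat_def Suc_leI card_gt_0_iff empty_iff)
  then obtain U where U: "U \<subseteq> \<Union>X" "card U = card (\<Union>X)" "gromov_rigid (Suc D) (\<Union>v\<in>U. star X v)"
    using ex by blast
  then have UX: "U = \<Union>X" using X(5) card_subset_eq by blast
  have "(\<Union>v\<in>\<Union>X. star X v) = X"
  proof
    show "(\<Union>v\<in>\<Union>X. star X v) \<subseteq> X" using star_subset[OF sc] by blast
    show "X \<subseteq> (\<Union>v\<in>\<Union>X. star X v)"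
    proof
      fix \<tau> assume \<tau>: "\<tau> \<in> X"
      show "\<tau> \<in> (\<Union>v\<in>\<Union>X. star X v)"
      proof (cases "\<tau> = {}")
        case True
        then show ?thesis using v0 vertex_in_complex[OF sc v0] by (auto simp: star_def)
      next
        case False
        then obtain v where "v \<in> \<tau>" by blast
        then have "\<tau> \<in> star X v" using \<tau> by (simp add: star_def insert_absorb)
        then show ?thesis using \<tau> \<open>v \<in> \<tau>\<close> by blast
      qed
    qed
  qed
  then show ?thesis using U(3) UX by simp
qed

section \<open>Closed surfaces\<close>

locale closed_surface =
  fixes X :: "'a set set"
  assumes nps: "normal_pseudomanifold 3 X"
begin

section \<open>Sets of triangles and their boundaries modulo 2\<close>

definition triangles :: "'a set set" where
  "triangles = {t\<in>X. card t = 3}"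

text \<open>The boundary of \<open>T\<close> modulo 2: for \<open>T \<subseteq> triangles\<close> an
  edge lies in at most two members of \<open>T\<close>, so "exactly one" is the same as "an odd
  number".\<close>

definition bd :: "'a set set \<Rightarrow> 'a set set" where
  "bd T = {e\<in>edges X. card {t\<in>T. e \<subseteq> t} = 1}"

lemma sc: "simplicial_complex X"
  using nps by (simp add: normal_pseudomanifold_def)

lemmas X = simplicial_complexD[OF sc]

lemma fin: "finite (edges X)" "finite triangles" "T \<subseteq> triangles \<Longrightarrow> finite T"
  using X(1) by (auto simp: edges_def triangles_def intro: finite_subset)

lemma connected_X: "cut_connected X"
  using nps X(2) unfolding normal_pseudomanifold_def by fastforce

lemma connected_vertex_link: "v \<in> \<Union>X \<Longrightarrow> cut_connected (link X {v})"
  using nps vertex_in_complex[OF sc, of v] unfolding normal_pseudomanifold_def by fastforce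

lemma in_triangle: "\<sigma> \<in> X \<Longrightarrow> \<exists>t\<in>triangles. \<sigma> \<subseteq> t"
  using nps unfolding normal_pseudomanifold_def triangles_def by blast

lemma card_triangles_containing_edge:
  assumes "e \<in> edges X"
  shows "card {t\<in>triangles. e \<subseteq> t} = 2"
proof -
  have e: "e \<in> X" "card e = 2" "finite e"
    using assms X(3) by (auto simp: edges_def)
  have "bij_betw (\<lambda>v. insert v e) (\<Union>(link X e)) {t\<in>triangles. e \<subseteq> t}"
  proof (rule bij_betw_imageI)
    show "inj_on (\<lambda>v. insert v e) (\<Union>(link X e))"
      by (rule inj_onI) (auto simp: in_Union_link[OF sc] simp del: Union_iff)
    show "(\<lambda>v. insert v e) ` \<Union>(link X e) = {t\<in>triangles. e \<subseteq> t}"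
    proof (intro set_eqI iffI)
      fix t assume "t \<in> (\<lambda>v. insert v e) ` \<Union>(link X e)"
      then obtain v where "v \<in> \<Union>(link X e)" "t = insert v e" by (elim imageE)
      then show "t \<in> {t\<in>triangles. e \<subseteq> t}"
        using e in_Union_link[OF sc, of v e] by (auto simp: triangles_def)
    next
      fix t assume t: "t \<in> {t\<in>triangles. e \<subseteq> t}"
      then have "card (t - e) = 1" using e by (simp add: triangles_def card_Diff_subset)
      then obtain v where "t - e = {v}" using card_1_singletonE by blast
      then have "t = insert v e" "v \<notin> e" using t by blast+
      then show "t \<in> (\<lambda>v. insert v e) ` \<Union>(link X e)"
        using t by (intro image_eqI[of _ _ v]) (auto simp: in_Union_link[OF sc] triangles_def simp del: Union_iff)
    qed
  qed
  then have "card {t\<in>triangles. e \<subseteq> t} = card (\<Union>(link X e))"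
    using bij_betw_same_card by metis
  also have "\<dots> = 2" using nps e unfolding normal_pseudomanifold_def by simp
  finally show ?thesis .
qed

lemma card_edges_of_triangle:
  assumes "t \<in> triangles"
  shows "card {e\<in>edges X. e \<subseteq> t} = 3"
proof -
  have "{e\<in>edges X. e \<subseteq> t} = {e. e \<subseteq> t \<and> card e = 2}"
    using assms X(4) by (auto simp: edges_def triangles_def)
  moreover have "finite t" "card t = 3" using assms X(3) by (auto simp: triangles_def)
  ultimately show ?thesis by (simp add: n_subsets eval_nat_numeral)
qed

lemma card_edges_of_triangle_at_vertex:
  assumes "t \<in> triangles" "u \<in> t"
  shows "card {e\<in>edges X. u \<in> e \<and> e \<subseteq> t} = 2"
proof -
  have t: "finite t" "card t = 3" "t \<in> X" using assms X(3) by (auto simp: triangles_def)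
  have "{e\<in>edges X. u \<in> e \<and> e \<subseteq> t} = (\<lambda>v. {u, v}) ` (t - {u})"
  proof (intro set_eqI iffI)
    fix e assume e: "e \<in> {e\<in>edges X. u \<in> e \<and> e \<subseteq> t}"
    then have "card (e - {u}) = 1" by (simp add: edges_def)
    then obtain v where "e - {u} = {v}" using card_1_singletonE by blast
    then have "v \<in> t - {u}" "e = {u, v}" using e by blast+
    then show "e \<in> (\<lambda>v. {u, v}) ` (t - {u})" by blast
  next
    fix e assume "e \<in> (\<lambda>v. {u, v}) ` (t - {u})"
    then show "e \<in> {e\<in>edges X. u \<in> e \<and> e \<subseteq> t}"
      using assms(2) X(4)[OF t(3), of e] by (auto simp: edges_def)
  qed
  moreover have "card ((\<lambda>v. {u, v}) ` (t - {u})) = card (t - {u})"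
    by (intro card_image) (auto simp: inj_on_def doubleton_eq_iff)
  ultimately show ?thesis using t assms(2) by simp
qed

lemma card_sub_triangles_containing_edge:
  assumes "e \<in> edges X" "T \<subseteq> triangles"
  shows "card {t\<in>T. e \<subseteq> t} \<le> 2"
  using card_mono[of "{t\<in>triangles. e \<subseteq> t}" "{t\<in>T. e \<subseteq> t}"] assms fin
    card_triangles_containing_edge[OF assms(1)] by auto

text \<open>A mod 2 boundary is a mod 2 cycle. Among the incidences at \<open>u\<close>, each
  triangle accounts for its two edges through \<open>u\<close>, so the total is even; the edges with
  an odd share are those of \<open>bd T\<close>.\<close>

lemma even_bd:
  assumes T: "T \<subseteq> triangles"
  shows "even (card {e\<in>bd T. u \<in> e})"
proof -
  let ?E = "{e\<in>edges X. u \<in> e}" and ?T = "{t\<in>T. u \<in> t}"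
  have "(\<Sum>e\<in>?E. card {t\<in>?T. e \<subseteq> t}) = (\<Sum>t\<in>?T. 2)"
  proof (rule sum_multicount_gen)
    show "\<forall>t\<in>?T. card {e\<in>?E. e \<subseteq> t} = 2"
      using card_edges_of_triangle_at_vertex[of _ u] T by (auto simp: conj_assoc)
  qed (use fin T in auto)
  then have "even (\<Sum>e\<in>?E. card {t\<in>?T. e \<subseteq> t})" by simp
  moreover have "odd (card {t\<in>?T. e \<subseteq> t}) \<longleftrightarrow> e \<in> bd T" if e: "e \<in> ?E" for e
  proof -
    have "{t\<in>?T. e \<subseteq> t} = {t\<in>T. e \<subseteq> t}" using e by blast
    moreover have "odd n \<longleftrightarrow> n = 1" if "n \<le> 2" for n :: nat
      using that by (auto simp: le_Suc_eq eval_nat_numeral)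
    ultimately show ?thesis
      using e card_sub_triangles_containing_edge[OF _ T, of e] by (auto simp: bd_def)
  qed
  then have "{e\<in>?E. odd (card {t\<in>?T. e \<subseteq> t})} = {e\<in>bd T. u \<in> e}"
    by (auto simp: bd_def)
  ultimately show ?thesis using fin(1) by (simp add: even_sum_iff)
qed

text \<open>Off \<open>bd T\<close> an edge lies in zero or two triangles of \<open>T\<close>, and
  two are all there are. Membership in \<open>T\<close> thus propagates across such an edge.\<close>

lemma other_triangle:
  assumes "T \<subseteq> triangles" "e \<in> edges X" "e \<notin> bd T" "e \<subseteq> s" "s \<in> T" "e \<subseteq> t" "t \<in> triangles"
  shows "t \<in> T"
proof -
  have "{t\<in>T. e \<subseteq> t} \<noteq> {}" "finite {t\<in>T. e \<subseteq> t}" using assms(4,5) fin(3)[OF assms(1)] by auto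
  then have "card {t\<in>T. e \<subseteq> t} \<noteq> 0" by simp
  moreover have "card {t\<in>T. e \<subseteq> t} \<noteq> 1" using assms(2,3) by (simp add: bd_def)
  ultimately have "card {t\<in>T. e \<subseteq> t} = card {t\<in>triangles. e \<subseteq> t}"
    using card_sub_triangles_containing_edge[OF assms(2,1)] card_triangles_containing_edge[OF assms(2)]
    by linarith
  then have "{t\<in>T. e \<subseteq> t} = {t\<in>triangles. e \<subseteq> t}"
    using assms(1) fin(2) by (intro card_subset_eq) auto
  then show ?thesis using assms(6,7) by blast
qed

lemma edge_of_triangle:
  assumes "t \<in> triangles" "x \<in> t" "y \<in> t" "x \<noteq> y" shows "{x, y} \<in> edges X"
  using assms X(4)[of t "{x, y}"] by (simp add: edges_def triangles_def)

text \<open>The triangles at \<open>u\<close> are the edges of the link of \<open>u\<close>, a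
  connected graph, and passing from one to the next crosses an edge at \<open>u\<close>, hence off
  \<open>bd T\<close>. So \<open>T\<close> contains all of them or none.\<close>

lemma triangles_at_vertex:
  assumes T: "T \<subseteq> triangles" and bd: "\<And>e. e \<in> bd T \<Longrightarrow> u \<notin> e"
    and s: "s \<in> T" "u \<in> s" and t: "t \<in> triangles" "u \<in> t"
  shows "t \<in> T"
proof -
  \<comment> \<open>The link vertices already covered by \<open>T\<close>; adjacency in the link
    does not leave this set, so the cut criterion makes it the whole link.\<close>
  define S where "S = {x. x \<noteq> u \<and> (\<exists>r\<in>T. {u, x} \<subseteq> r)}"
  have closed: "r \<in> T" if "x \<in> S" "r \<in> triangles" "u \<in> r" "x \<in> r" for x r
  proof -
    obtain q where q: "q \<in> T" "{u, x} \<subseteq> q" "x \<noteq> u"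
      using \<open>x \<in> S\<close> unfolding S_def by blast
    have "{u, x} \<in> edges X" using edge_of_triangle[of r u x] q(3) that by blast
    then show ?thesis using other_triangle[OF T _ _ q(2,1) _ that(2)] bd that by blast
  qed
  have lkS: "S \<subseteq> \<Union>(link X {u})"
  proof
    fix x assume "x \<in> S"
    then obtain r where "r \<in> T" "{u, x} \<subseteq> r" "x \<noteq> u" by (auto simp: S_def)
    then have "{u, x} \<in> X" using T X(4)[of r] by (auto simp: triangles_def)
    then show "x \<in> \<Union>(link X {u})"
      using in_Union_link[OF sc, of x "{u}"] \<open>x \<noteq> u\<close> by (simp add: insert_commute)
  qed
  have other: "\<exists>x\<in>r. x \<noteq> u" if "r \<in> triangles" for r
  proof (rule ccontr)
    assume "\<not> ?thesis"
    then have "r \<subseteq> {u}" by blast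
    then have "card r \<le> card {u}" by (intro card_mono) auto
    then show False using that by (simp add: triangles_def)
  qed
  have "S \<noteq> {}" using other[of s] s T by (auto simp: S_def)
  moreover have "u \<in> \<Union>X" using t by (auto simp: triangles_def)
  moreover have False if "x \<in> S" "y \<in> \<Union>(link X {u}) - S" "{x, y} \<in> link X {u}" for x y
  proof -
    have r: "{x, y} \<union> {u} \<in> X" "x \<noteq> u" "y \<noteq> u" "x \<noteq> y" using that by (auto simp: link_def)
    then have "{x, y} \<union> {u} \<in> triangles" by (simp add: triangles_def)
    then have "{x, y} \<union> {u} \<in> T" using closed[OF that(1)] by blast
    then have "y \<in> S" using r by (auto simp: S_def)
    then show False using that(2) by blast
  qed
  ultimately have "S = \<Union>(link X {u})"
    using connected_vertex_link[of u] lkS unfolding cut_connected_def by meson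
  moreover obtain x where "x \<in> t" "x \<noteq> u" using other[OF t(1)] by blast
  moreover have "x \<in> \<Union>(link X {u})"
    using in_Union_link[OF sc, of x "{u}"] edge_of_triangle[OF t(1), of x u] t \<open>x \<in> t\<close> \<open>x \<noteq> u\<close>
    by (simp add: edges_def)
  ultimately show "t \<in> T" using closed t by blast
qed

end

section \<open>Counting in graphs\<close>

text \<open>
  The edge sets obtained here are spanning forests rooted outside \<open>A\<close>; the last condition
  expresses acyclicity, a leaf of \<open>B\<close> being a vertex of \<open>A\<close> on exactly one edge of \<open>B\<close>.
\<close>

lemma rooted_spanning_forest:
  assumes sc: "simplicial_complex X" and conn: "cut_connected X" and A: "A \<subseteq> \<Union>X" "A \<noteq> \<Union>X"
  obtains F where "F \<subseteq> edges_meeting X A" "card F = card A"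
    "\<And>B. B \<subseteq> F \<Longrightarrow> B \<noteq> {} \<Longrightarrow> \<exists>v\<in>A. card {e\<in>B. v \<in> e} = 1"
proof -
  note X = simplicial_complexD[OF sc]
  have finA: "finite A" using finite_subset[OF A(1) X(5)] .
  \<comment> \<open>\<open>U\<close> is the part reached so far, starting from the complement of
    \<open>A\<close> and gaining one vertex of \<open>A\<close> per edge. The invariant
    \<open>\<Union>F \<subseteq> U\<close> keeps the next vertex off all earlier edges.\<close>
  have "\<exists>U F. \<Union>X - A \<subseteq> U \<and> U \<subseteq> \<Union>X \<and> card (U \<inter> A) = n \<and> \<Union>F \<subseteq> U \<and>
      F \<subseteq> edges_meeting X A \<and> card F = n \<and> finite F \<and>
      (\<forall>B\<subseteq>F. B \<noteq> {} \<longrightarrow> (\<exists>v\<in>A. card {e\<in>B. v \<in> e} = 1))"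
    if "n \<le> card A" for n
    using that
  proof (induction n)
    case 0
    have "(\<Union>X - A) \<inter> A = {}" by blast
    then show ?case by (intro exI[of _ "\<Union>X - A"] exI[of _ "{}"]) simp
  next
    case (Suc n)
    from Suc.IH[OF Suc_leD[OF Suc.prems]]
    obtain U F where U: "\<Union>X - A \<subseteq> U" "U \<subseteq> \<Union>X" "card (U \<inter> A) = n"
      and F: "\<Union>F \<subseteq> U" "F \<subseteq> edges_meeting X A" "card F = n" "finite F"
      and ac: "\<forall>B\<subseteq>F. B \<noteq> {} \<longrightarrow> (\<exists>v\<in>A. card {e\<in>B. v \<in> e} = 1)"
      by (elim exE conjE)
    have "U \<noteq> {}" using U(1) A by blast
    moreover have "U \<noteq> \<Union>X"
    proof
      assume "U = \<Union>X"
      then have "U \<inter> A = A" using A(1) by blast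
      then show False using U(3) Suc.prems by simp
    qed
    ultimately obtain x y where xy: "x \<in> U" "y \<in> \<Union>X - U" "{x, y} \<in> X"
      using conn U(2) unfolding cut_connected_def by meson
    let ?e = "{x, y}"
    have yA: "y \<in> A" using xy(2) U(1) by blast
    have "x \<noteq> y" using xy by blast
    then have e: "?e \<in> edges_meeting X A"
      using xy(3) yA by (simp add: edges_meeting_def edges_def)
    have new: "?e \<notin> F" using F(1) xy(2) by blast
    have leaf: "\<exists>v\<in>A. card {e\<in>B. v \<in> e} = 1" if "B \<subseteq> insert ?e F" "B \<noteq> {}" for B
    proof (cases "?e \<in> B")
      case True
      \<comment> \<open>The latest vertex \<open>y\<close> is the leaf: it lies outside
        \<open>U\<close>, so on no edge of \<open>F\<close>.\<close>
      have "{e\<in>B. y \<in> e} = {?e}" using True that(1) F(1) xy(2) by blast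
      then show ?thesis using yA by (intro bexI[of _ y]) simp_all
    next
      case False
      then show ?thesis using ac that by blast
    qed
    have "insert y U \<inter> A = insert y (U \<inter> A)" using yA by blast
    then have "card (insert y U \<inter> A) = Suc n" using xy(2) finA U(3) by simp
    moreover have "card (insert ?e F) = Suc n" using new F by simp
    moreover have "\<Union>(insert ?e F) \<subseteq> insert y U" using F(1) xy(1) by blast
    ultimately show ?case
      using U xy(2) F(2,4) e leaf
      by (intro exI[of _ "insert y U"] exI[of _ "insert ?e F"]) blast
  qed
  from this[OF order_refl] obtain F where "F \<subseteq> edges_meeting X A" "card F = card A"
    "\<forall>B\<subseteq>F. B \<noteq> {} \<longrightarrow> (\<exists>v\<in>A. card {e\<in>B. v \<in> e} = 1)"
    by (elim exE conjE)
  then show ?thesis using that[of F] by simp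
qed

text \<open>A connected graph on \<open>n\<close> nodes has at least \<open>n - 1\<close> edges,
  with incidence an arbitrary relation so that it applies to dual graphs. Nodes are added along
  crossing edges; all ends of used edges are already in \<open>S\<close>, so a crossing edge is
  new.\<close>

lemma card_edges_ge_of_connected:
  assumes fin: "finite T" "finite E" and T: "T \<noteq> {}"
    and inc: "\<And>e. e \<in> E \<Longrightarrow> card {t\<in>T. R e t} \<le> 2"
    and cut: "\<And>S. S \<subseteq> T \<Longrightarrow> S \<noteq> {} \<Longrightarrow> S \<noteq> T \<Longrightarrow> \<exists>e\<in>E. \<exists>s\<in>S. \<exists>t\<in>T - S. R e s \<and> R e t"
  shows "card T \<le> card E + 1"
proof -
  have "\<exists>S G. S \<subseteq> T \<and> G \<subseteq> E \<and> card S = Suc n \<and> card G = n \<and> (\<forall>e\<in>G. \<forall>t\<in>T. R e t \<longrightarrow> t \<in> S)"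
    if "Suc n \<le> card T" for n
    using that
  proof (induction n)
    case 0
    obtain t where "t \<in> T" using T by blast
    then show ?case by (intro exI[of _ "{t}"] exI[of _ "{}"]) simp
  next
    case (Suc n)
    then obtain S G where S: "S \<subseteq> T" "card S = Suc n" and G: "G \<subseteq> E" "card G = n"
      and closed: "\<And>e t. e \<in> G \<Longrightarrow> t \<in> T \<Longrightarrow> R e t \<Longrightarrow> t \<in> S"
      by (metis Suc_leD)
    have "S \<noteq> {}" "S \<noteq> T" using S(2) Suc.prems by auto
    then obtain e s t where e: "e \<in> E" "s \<in> S" "t \<in> T - S" "R e s" "R e t" using cut S(1) by blast
    have fins: "finite S" "finite G" using fin S(1) G(1) by (auto intro: finite_subset)
    \<comment> \<open>With at most two ends, \<open>e\<close> has no third node outside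
      \<open>insert t S\<close>, so the invariant survives.\<close>
    have two: "{r\<in>T. R e r} = {s, t}"
    proof (rule card_seteq[symmetric])
      have "s \<noteq> t" using e by blast
      then show "card {r\<in>T. R e r} \<le> card {s, t}" using inc[OF e(1)] by simp
    qed (use fin e S(1) in auto)
    have "e \<notin> G" using closed e by blast
    then have "card (insert e G) = Suc n" using fins G(2) by simp
    moreover have "card (insert t S) = Suc (Suc n)" using fins S(2) e(3) by simp
    moreover have "\<forall>e'\<in>insert e G. \<forall>r\<in>T. R e' r \<longrightarrow> r \<in> insert t S"
    proof (intro ballI impI)
      fix e' r assume "e' \<in> insert e G" "r \<in> T" "R e' r"
      moreover from this have "r \<in> {s, t}" if "e' = e" using that unfolding two[symmetric] by simp
      ultimately show "r \<in> insert t S" using closed[of e' r] e(2) by blast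
    qed
    ultimately show ?case
      using S(1) G(1) e(1,3) by (intro exI[of _ "insert t S"] exI[of _ "insert e G"]) blast
  qed
  moreover have "card T \<noteq> 0" using fin T by simp
  ultimately obtain G where "G \<subseteq> E" "card G = card T - 1"
    by (metis Suc_pred' gr0I order_refl)
  then show ?thesis using card_mono[OF fin(2), of G] by simp
qed

text \<open>Even degrees leave no leaf, so at each end of an edge there is a further edge. These two
  differ, since an edge is determined by its two ends.\<close>

lemma card_ge_3_of_even_degrees:
  assumes fin: "finite Z" and two: "\<And>e. e \<in> Z \<Longrightarrow> card e = 2" and "Z \<noteq> {}"
    and ev: "\<And>u. even (card {e\<in>Z. u \<in> e})"
  shows "3 \<le> card Z"
proof -
  have other: "\<exists>e'\<in>Z. e' \<noteq> e \<and> u \<in> e'" if "e \<in> Z" "u \<in> e" for e u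
  proof (rule ccontr)
    assume "\<not> ?thesis"
    then have "{e\<in>Z. u \<in> e} = {e}" using that by blast
    then show False using ev[of u] by simp
  qed
  obtain e where e: "e \<in> Z" using assms(3) by blast
  then obtain x y where xy: "e = {x, y}" "x \<noteq> y" using two[OF e] by (meson card_2_iff)
  obtain a b where a: "a \<in> Z" "a \<noteq> e" "x \<in> a" and b: "b \<in> Z" "b \<noteq> e" "y \<in> b"
    using other[OF e] xy(1) by blast
  have "a \<noteq> b"
  proof
    assume ab: "a = b"
    have "finite a" using two[OF a(1)] card.infinite by fastforce
    then have "e = a" using a b(3) ab xy two[OF a(1)] by (intro card_seteq) auto
    then show False using a(2) by blast
  qed
  then have "card {e, a, b} = 3" using a b by auto
  moreover have "card {e, a, b} \<le> card Z" using e a b fin by (intro card_mono) auto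
  ultimately show ?thesis by simp
qed

section \<open>Forests and dual graphs on a surface\<close>

context closed_surface
begin

text \<open>Without boundary, \<open>T\<close> contains all or none of the triangles at each vertex.
  The vertices it covers are then closed under adjacency, and connectedness makes \<open>T\<close>
  everything.\<close>

lemma bd_nonempty:
  assumes T: "T \<subseteq> triangles" "T \<noteq> {}" "T \<noteq> triangles"
  shows "bd T \<noteq> {}"
proof
  assume empty: "bd T = {}"
  obtain s t where s: "s \<in> T" and t: "t \<in> triangles" "t \<notin> T" using T by blast
  define S where "S = {v\<in>\<Union>X. \<exists>r\<in>T. v \<in> r}"
  have all: "r \<in> T" if "v \<in> S" "r \<in> triangles" "v \<in> r" for v r
    using triangles_at_vertex[OF T(1)] that empty by (auto simp: S_def)
  have nonempty: "r \<noteq> {}" if "r \<in> triangles" for r using that by (auto simp: triangles_def)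
  have "S \<noteq> {}" using s T(1) nonempty[of s] by (auto simp: S_def triangles_def)
  moreover have "S \<noteq> \<Union>X" using all nonempty[OF t(1)] t by (auto simp: triangles_def)
  moreover have "S \<subseteq> \<Union>X" by (auto simp: S_def)
  ultimately obtain x y where xy: "x \<in> S" "y \<in> \<Union>X - S" "{x, y} \<in> X"
    using connected_X unfolding cut_connected_def by meson
  obtain r where "r \<in> triangles" "{x, y} \<subseteq> r" using in_triangle[OF xy(3)] by blast
  then have "y \<in> S" using all[OF xy(1)] xy(2) by (auto simp: S_def)
  then show False using xy(2) by blast
qed

text \<open>The edges of \<open>bd S\<close> that meet \<open>A\<close> are the dual edges leaving
  \<open>S\<close>. If all of them were in the forest \<open>F\<close>, a leaf would contradict
  \<open>even_bd\<close> unless there were none; and if there were none, the vertices of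
  \<open>A\<close> covered by \<open>S\<close> would split off from the rest of \<open>A\<close>,
  against \<open>indec\<close>.\<close>

lemma dual_graph_minus_forest_connected:
  assumes A: "A \<subseteq> \<Union>X"
    and indec: "\<And>B. B \<subseteq> A \<Longrightarrow> B \<noteq> {} \<Longrightarrow> B \<noteq> A \<Longrightarrow> \<exists>x\<in>B. \<exists>y\<in>A - B. {x, y} \<in> X"
    and leaf: "\<And>B. B \<subseteq> F \<Longrightarrow> B \<noteq> {} \<Longrightarrow> \<exists>v\<in>A. card {e\<in>B. v \<in> e} = 1"
    and S: "S \<subseteq> {t\<in>triangles. t \<inter> A \<noteq> {}}" "S \<noteq> {}" "S \<noteq> {t\<in>triangles. t \<inter> A \<noteq> {}}"
  shows "\<exists>e\<in>edges_meeting X A - F. e \<in> bd S"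
proof (rule ccontr)
  assume "\<not> ?thesis"
  then have sub: "bd S \<inter> edges_meeting X A \<subseteq> F" by blast
  have ST: "S \<subseteq> triangles" using S(1) by blast
  have none: "bd S \<inter> edges_meeting X A = {}"
  proof (rule ccontr)
    assume "bd S \<inter> edges_meeting X A \<noteq> {}"
    then obtain v where v: "v \<in> A" "card {e\<in>bd S \<inter> edges_meeting X A. v \<in> e} = 1"
      using leaf[OF sub] by blast
    \<comment> \<open>Every edge at a vertex of \<open>A\<close> meets \<open>A\<close>, so the leaf
      has degree 1 in all of \<open>bd S\<close>.\<close>
    have "{e\<in>bd S \<inter> edges_meeting X A. v \<in> e} = {e\<in>bd S. v \<in> e}"
      using v(1) by (auto simp: bd_def edges_meeting_def)
    then show False using v(2) even_bd[OF ST, of v] by simp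
  qed
  have all: "r \<in> S" if "s \<in> S" "v \<in> A" "v \<in> s" "r \<in> triangles" "v \<in> r" for s r v
  proof (rule triangles_at_vertex[OF ST _ that(1,3,4,5)])
    show "v \<notin> e" if "e \<in> bd S" for e
      using none that \<open>v \<in> A\<close> by (auto simp: bd_def edges_meeting_def)
  qed
  define B where "B = {v\<in>A. \<exists>s\<in>S. v \<in> s}"
  have "B \<noteq> {}" using S(1,2) by (auto simp: B_def)
  moreover have "B \<noteq> A"
  proof -
    obtain t v where t: "t \<in> triangles" "v \<in> t" "v \<in> A" "t \<notin> S" using S by blast
    then have "v \<notin> B" using all by (auto simp: B_def)
    then show ?thesis using t by blast
  qed
  moreover have "B \<subseteq> A" by (auto simp: B_def)
  ultimately obtain x y where xy: "x \<in> B" "y \<in> A - B" "{x, y} \<in> X" using indec by meson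
  obtain r where r: "r \<in> triangles" "{x, y} \<subseteq> r" using in_triangle[OF xy(3)] by blast
  then have "r \<in> S" using all[of _ x r] xy(1) by (auto simp: B_def)
  then show False using r xy(2) by (auto simp: B_def)
qed

text \<open>
  Let \<open>e\<close> and \<open>t\<close> count the edges and triangles meeting \<open>A\<close>.  Deleting the dual edges of a
  spanning forest leaves the dual graph connected, so \<open>e - card A \<ge> t - 1\<close>; and
  \<open>3t \<ge> 2e + 3\<close>, as the triangles meeting \<open>A\<close> have at least three boundary edges.
\<close>

lemma card_edges_meeting_indecomposable:
  assumes A: "A \<subseteq> \<Union>X" "A \<noteq> {}"
    and indec: "\<And>B. B \<subseteq> A \<Longrightarrow> B \<noteq> {} \<Longrightarrow> B \<noteq> A \<Longrightarrow> \<exists>x\<in>B. \<exists>y\<in>A - B. {x, y} \<in> X"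
    and \<sigma>: "\<sigma> \<in> triangles" "\<sigma> \<inter> A = {}"
  shows "3 * card A \<le> card (edges_meeting X A)"
proof -
  let ?E = "edges_meeting X A" and ?T = "{t\<in>triangles. t \<inter> A \<noteq> {}}"
  have TT: "?T \<subseteq> triangles" by blast
  have finE: "finite ?E" using fin by (simp add: edges_meeting_def)
  have "\<sigma> \<subseteq> \<Union>X" "\<sigma> \<noteq> {}" using \<sigma>(1) by (auto simp: triangles_def)
  then have "A \<noteq> \<Union>X" using \<sigma>(2) by blast
  with A(1) obtain F where F: "F \<subseteq> ?E" "card F = card A"
    and leaf: "\<And>B. B \<subseteq> F \<Longrightarrow> B \<noteq> {} \<Longrightarrow> \<exists>v\<in>A. card {e\<in>B. v \<in> e} = 1"
    using rooted_spanning_forest[OF sc connected_X] by metis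
  have Tne: "?T \<noteq> {}"
  proof -
    obtain v where v: "v \<in> A" using A(2) by blast
    then obtain t where "t \<in> triangles" "{v} \<subseteq> t"
      using in_triangle[OF vertex_in_complex[OF sc, of v]] A(1) by blast
    then show ?thesis using v by blast
  qed
  \<comment> \<open>A triangle on an edge that meets \<open>A\<close> meets \<open>A\<close> itself,
    so both triangles of such an edge are in \<open>?T\<close>.\<close>
  have full: "{t\<in>?T. e \<subseteq> t} = {t\<in>triangles. e \<subseteq> t}" if "e \<in> ?E" for e
    using that by (auto simp: edges_meeting_def)
  have E2: "card {t\<in>?T. e \<subseteq> t} = 2" if "e \<in> ?E" for e
    unfolding full[OF that] using that
    by (intro card_triangles_containing_edge) (simp add: edges_meeting_def)
  have "card ?T \<le> card (?E - F) + 1"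
  proof (rule card_edges_ge_of_connected[where R = "(\<subseteq>)", OF fin(3)[OF TT] _ Tne])
    show "finite (?E - F)" using finE by simp
    show "card {t\<in>?T. e \<subseteq> t} \<le> 2" if "e \<in> ?E - F" for e using E2[of e] that by simp
    fix S assume S: "S \<subseteq> ?T" "S \<noteq> {}" "S \<noteq> ?T"
    have "\<exists>e\<in>?E - F. e \<in> bd S"
      using A(1) indec leaf S by (rule dual_graph_minus_forest_connected)
    then obtain e where e: "e \<in> ?E - F" "e \<in> bd S" by blast
    then have "card {t\<in>S. e \<subseteq> t} = 1" by (simp add: bd_def)
    then obtain s where s: "{t\<in>S. e \<subseteq> t} = {s}" using card_1_singletonE by blast
    have "\<exists>t\<in>?T - S. e \<subseteq> t"
    proof (rule ccontr)
      assume "\<not> ?thesis"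
      then have "{t\<in>?T. e \<subseteq> t} = {t\<in>S. e \<subseteq> t}" using S(1) by blast
      then show False using s E2[of e] e(1) by simp
    qed
    moreover have "s \<in> S" "e \<subseteq> s" using s by blast+
    ultimately show "\<exists>e\<in>?E - F. \<exists>s\<in>S. \<exists>t\<in>?T - S. e \<subseteq> s \<and> e \<subseteq> t" using e(1) by blast
  qed
  moreover have "card (?E - F) + card A = card ?E"
    using F finE by (metis card_Diff_subset card_mono finite_subset le_add_diff_inverse2)
  \<comment> \<open>Incidences of edges with triangles of \<open>?T\<close>: an edge meeting
    \<open>A\<close> has two, an edge of \<open>bd ?T\<close> one, and each triangle has
    three.\<close>
  moreover have "2 * card ?E + card (bd ?T) \<le> 3 * card ?T"
  proof -
    have "2 * card ?E + card (bd ?T)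
        = (\<Sum>e\<in>?E. card {t\<in>?T. e \<subseteq> t}) + (\<Sum>e\<in>bd ?T. card {t\<in>?T. e \<subseteq> t})"
      using E2 by (simp add: bd_def)
    also have "\<dots> = (\<Sum>e\<in>?E \<union> bd ?T. card {t\<in>?T. e \<subseteq> t})"
    proof (rule sum.union_disjoint[symmetric])
      have "e \<notin> bd ?T" if "e \<in> ?E" for e using E2[OF that] by (simp add: bd_def)
      then show "?E \<inter> bd ?T = {}" by blast
    qed (use finE fin in \<open>auto simp: bd_def\<close>)
    also have "\<dots> \<le> (\<Sum>e\<in>edges X. card {t\<in>?T. e \<subseteq> t})"
      using fin by (intro sum_mono2) (auto simp: bd_def edges_meeting_def)
    also have "\<dots> = (\<Sum>t\<in>?T. 3)"
    proof (rule sum_multicount_gen)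
      show "\<forall>t\<in>?T. card {e\<in>edges X. e \<subseteq> t} = 3" using card_edges_of_triangle by blast
    qed (use fin in auto)
    finally show ?thesis by simp
  qed
  moreover have "3 \<le> card (bd ?T)"
  proof (rule card_ge_3_of_even_degrees)
    show "bd ?T \<noteq> {}" using bd_nonempty[OF TT Tne] \<sigma> by blast
    show "even (card {e\<in>bd ?T. u \<in> e})" for u using even_bd[OF TT] .
    show "finite (bd ?T)" using fin(1) by (simp add: bd_def)
  qed (simp add: bd_def edges_def)
  \<comment> \<open>With \<open>a = card A\<close>: \<open>2e + 3 \<le> 3t\<close> and
    \<open>t \<le> e - a + 1\<close> give \<open>3a \<le> e\<close>. The three boundary edges
    exactly absorb the 1 of the dual tree.\<close>
  ultimately show ?thesis by linarith
qed

text \<open>If \<open>A\<close> splits into two parts with no edge between them, no edge meets both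
  parts and their bounds add up. This reduces the claim to indecomposable \<open>A\<close>.\<close>

lemma gromov_rigid_surface: "gromov_rigid 3 X"
proof -
  have "3 * card A \<le> card (edges_meeting X A)"
    if "A \<subseteq> \<Union>X" "\<sigma> \<in> triangles" "\<sigma> \<inter> A = {}" for A \<sigma>
    using that
  proof (induction "card A" arbitrary: A rule: less_induct)
    case less
    have finA: "finite A" using finite_subset[OF less.prems(1) X(5)] .
    show ?case
    proof (cases "\<exists>B\<subseteq>A. B \<noteq> {} \<and> B \<noteq> A \<and> (\<forall>x\<in>B. \<forall>y\<in>A - B. {x, y} \<notin> X)")
      case True
      then obtain B where B: "B \<subseteq> A" "B \<noteq> {}" "B \<noteq> A"
        and sep: "\<And>x y. x \<in> B \<Longrightarrow> y \<in> A - B \<Longrightarrow> {x, y} \<notin> X" by blast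
      have finB: "finite B" using finite_subset[OF B(1) finA] .
      have "B \<subset> A" "A - B \<subset> A" using B by blast+
      then have "card B < card A" "card (A - B) < card A" using finA by (auto intro: psubset_card_mono)
      then have IH: "3 * card B \<le> card (edges_meeting X B)"
        "3 * card (A - B) \<le> card (edges_meeting X (A - B))"
        using less.hyps less.prems B(1) by blast+
      have finE: "finite (edges_meeting X C)" for C using fin by (simp add: edges_meeting_def)
      have disj: "edges_meeting X B \<inter> edges_meeting X (A - B) = {}"
      proof (rule ccontr)
        assume "\<not> ?thesis"
        then obtain e x y where e: "e \<in> edges X" "x \<in> e" "y \<in> e" "x \<in> B" "y \<in> A - B"
          unfolding edges_meeting_def by blast
        then have "{x, y} \<in> X" using X(4)[of e "{x, y}"] by (simp add: edges_def)
        then show False using sep e by blast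
      qed
      have "card (edges_meeting X B) + card (edges_meeting X (A - B))
          = card (edges_meeting X B \<union> edges_meeting X (A - B))"
        using disj finE by (simp add: card_Un_disjoint)
      also have "\<dots> \<le> card (edges_meeting X A)"
        using B(1) finE by (intro card_mono) (auto simp: edges_meeting_def)
      finally have "card (edges_meeting X B) + card (edges_meeting X (A - B))
        \<le> card (edges_meeting X A)" .
      moreover have "card A = card B + card (A - B)"
        using B(1) finA finB by (metis card_Diff_subset card_mono le_add_diff_inverse)
      ultimately show ?thesis using IH by linarith
    next
      case False
      show ?thesis
      proof (cases "A = {}")
        case nonempty: False
        show ?thesis
        proof (rule card_edges_meeting_indecomposable[OF less.prems(1) nonempty _ less.prems(2,3)])
          show "\<exists>x\<in>B. \<exists>y\<in>A - B. {x, y} \<in> X" if "B \<subseteq> A" "B \<noteq> {}" "B \<noteq> A" for B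
            using False that by blast
        qed
      qed simp
    qed
  qed
  then show ?thesis unfolding gromov_rigid_def triangles_def by blast
qed

end

section \<open>The lower bound theorem\<close>

theorem gromov_rigid_normal_pseudomanifold:
  assumes "normal_pseudomanifold D X" "3 \<le> D"
  shows "gromov_rigid D X"
  using assms(2,1)
proof (induction D arbitrary: X rule: dec_induct)
  case base
  then interpret closed_surface X by unfold_locales
  show ?case by (rule gromov_rigid_surface)
next
  case (step D)
  have sc: "simplicial_complex X" using step.prems by (simp add: normal_pseudomanifold_def)
  show ?case
  proof (rule gromov_rigid_of_links[OF sc])
    have "{} \<in> X" using simplicial_complexD(2)[OF sc] .
    then show "cut_connected X"
      using step.prems step.hyps unfolding normal_pseudomanifold_def by fastforce
    show "card \<sigma> \<le> Suc D \<and> (\<exists>\<tau>\<in>X. \<sigma> \<subseteq> \<tau> \<and> card \<tau> = Suc D)" if "\<sigma> \<in> X" for \<sigma>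
      using step.prems that unfolding normal_pseudomanifold_def by blast
    show "gromov_rigid D (link X {v})" if "v \<in> \<Union>X" for v
      using normal_pseudomanifold_link[OF step.prems vertex_in_complex[OF sc that]] step.IH by simp
  qed
qed

text \<open>Rigidity for the vertices off a facet \<open>\<sigma>\<close>: the edges not met are the
  \<open>D choose 2\<close> edges of \<open>\<sigma>\<close>, and
  \<open>D * D - (D choose 2)\<close> is the constant \<open>D + 1 choose 2\<close>.\<close>

theorem lower_bound_normal_pseudomanifold:
  assumes X: "normal_pseudomanifold D X" and D: "3 \<le> D"
  shows "D * card (\<Union>X) \<le> card (edges X) + (D + 1 choose 2)"
proof -
  have sc: "simplicial_complex X" using X by (simp add: normal_pseudomanifold_def)
  note C = simplicial_complexD[OF sc]
  obtain \<sigma> where \<sigma>: "\<sigma> \<in> X" "card \<sigma> = D"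
    using X C(2) unfolding normal_pseudomanifold_def by blast
  have fs: "finite \<sigma>" using C(3)[OF \<sigma>(1)] .
  have "D * card (\<Union>X - \<sigma>) \<le> card (edges_meeting X (\<Union>X - \<sigma>))"
    using gromov_rigid_normal_pseudomanifold[OF X D] \<sigma> unfolding gromov_rigid_def by blast
  moreover have "card (\<Union>X - \<sigma>) + D = card (\<Union>X)"
  proof -
    have "\<sigma> \<subseteq> \<Union>X" using \<sigma>(1) by blast
    then show ?thesis
      using \<sigma>(2) fs C(5) card_Diff_subset[OF fs, of "\<Union>X"] card_mono[of "\<Union>X" \<sigma>] by simp
  qed
  moreover have "card (edges_meeting X (\<Union>X - \<sigma>)) + (D choose 2) = card (edges X)"
  proof -
    let ?K = "{e. e \<subseteq> \<sigma> \<and> card e = 2}"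
    have "edges X = edges_meeting X (\<Union>X - \<sigma>) \<union> ?K" "edges_meeting X (\<Union>X - \<sigma>) \<inter> ?K = {}"
      using C(4)[OF \<sigma>(1)] by (auto simp: edges_meeting_def edges_def)
    moreover have "finite (edges X)" using C(1) by (simp add: edges_def)
    ultimately show ?thesis
      using n_subsets[OF fs, of 2] \<sigma>(2) by (metis card_Un_disjoint finite_Un)
  qed
  moreover have "(D choose 2) + (D + 1 choose 2) = D * D"
    using D by (induction D rule: dec_induct) (simp_all add: eval_nat_numeral)
  moreover have "D * card (\<Union>X) = D * card (\<Union>X - \<sigma>) + D * D"
    unfolding calculation(2)[symmetric] by (simp add: distrib_left)
  ultimately show ?thesis by linarith
qed

section \<open>Reduced homology in degree 0\<close>

lemma cut_connected_of_connected_complex: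
  assumes "connected_complex X"
  shows "cut_connected X"
  unfolding cut_connected_def
proof (intro allI impI, rule ccontr)
  fix S assume S: "S \<subseteq> \<Union>X" "S \<noteq> {}" "S \<noteq> \<Union>X"
    and no: "\<not> (\<exists>x\<in>S. \<exists>y\<in>\<Union>X - S. {x, y} \<in> X)"
  obtain x y where xy: "x \<in> S" "y \<in> \<Union>X" "y \<notin> S" using S by blast
  then have "(x, y) \<in> {(x, y). {x, y} \<in> X}\<^sup>*"
    using assms S(1) unfolding connected_complex_def by blast
  then have "y \<in> S"
  proof (induction rule: rtrancl_induct)
    case (step a b)
    then have "{a, b} \<in> X" by simp
    then have "b \<in> \<Union>X" by blast
    then show ?case using no step.IH \<open>{a, b} \<in> X\<close> by blast
  qed (rule xy(1))
  then show False using xy(3) by blast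
qed

section \<open>Linear algebra of chain spaces\<close>

lemma sum_fun_apply: "(\<Sum>v\<in>V. g v) x = (\<Sum>v\<in>V. g v x)" for g :: "'a \<Rightarrow> 'b \<Rightarrow> 'c::comm_monoid_add"
  by (induction V rule: infinite_finite_induct) simp_all

lemma subspace_chains: "chain_space.subspace (chains X i :: ('a list \<Rightarrow> 'k::field) set)"
  unfolding chain_space.subspace_def
proof (intro conjI ballI allI)
  show "0 \<in> (chains X i :: ('a list \<Rightarrow> 'k) set)" by (simp add: chains_def)
next
  fix c b :: "'a list \<Rightarrow> 'k" assume c: "c \<in> chains X i" and b: "b \<in> chains X i"
  have "distinct xs \<and> set xs \<in> X \<and> face_dim (set xs) = i" if "(c + b) xs \<noteq> 0" for xs
  proof -
    have "c xs \<noteq> 0 \<or> b xs \<noteq> 0" using that by auto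
    then show ?thesis using chains_supp[OF c] chains_supp[OF b] by blast
  qed
  moreover have "(c + b) (xs @ x # y # ys) = - (c + b) (xs @ y # x # ys)" for xs x y ys
    using chains_swap[OF c, of xs x y ys] chains_swap[OF b, of xs x y ys] by simp
  ultimately show "c + b \<in> chains X i" unfolding chains_def by blast
next
  fix a :: 'k and c :: "'a list \<Rightarrow> 'k" assume c: "c \<in> chains X i"
  have "distinct xs \<and> set xs \<in> X \<and> face_dim (set xs) = i" if "a * c xs \<noteq> 0" for xs
    using that chains_supp[OF c, of xs] by simp
  moreover have "a * c (xs @ x # y # ys) = - (a * c (xs @ y # x # ys))" for xs x y ys
    using chains_swap[OF c, of xs x y ys] by simp
  ultimately show "(\<lambda>xs. a * c xs) \<in> chains X i" unfolding chains_def by blast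
qed

lemma boundary_linear:
  fixes c b :: "'a list \<Rightarrow> 'k::field"
  shows "boundary X 0 = (0 :: 'a list \<Rightarrow> 'k)" "boundary X (c + b) = boundary X c + boundary X b"
    "boundary X (\<lambda>xs. a * c xs) = (\<lambda>xs. a * boundary X c xs)"
  by (auto simp: boundary_def fun_eq_iff sum.distrib sum_distrib_left)

lemma subspace_boundaries: "chain_space.subspace (boundaries X i :: ('a list \<Rightarrow> 'k::field) set)"
proof -
  note C = subspace_chains[of X "i + 1", where 'k = 'k]
  show ?thesis
    unfolding chain_space.subspace_def boundaries_def
  proof (intro conjI ballI allI)
    show "0 \<in> boundary X ` (chains X (i + 1) :: ('a list \<Rightarrow> 'k) set)"
      by (rule image_eqI[of _ _ 0]) (simp_all add: boundary_linear(1) chain_space.subspace_0[OF C])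
  next
    fix c b :: "'a list \<Rightarrow> 'k"
    assume "c \<in> boundary X ` chains X (i + 1)" "b \<in> boundary X ` chains X (i + 1)"
    then obtain c' b' where "c' \<in> chains X (i + 1)" "b' \<in> chains X (i + 1)"
      "c = boundary X c'" "b = boundary X b'" by blast
    then show "c + b \<in> boundary X ` chains X (i + 1)"
      by (intro image_eqI[of _ _ "c' + b'"]) (simp_all add: boundary_linear(2) chain_space.subspace_add[OF C])
  next
    fix a :: 'k and c :: "'a list \<Rightarrow> 'k" assume "c \<in> boundary X ` chains X (i + 1)"
    then obtain b where "b \<in> chains X (i + 1)" "c = boundary X b" by blast
    then show "(\<lambda>xs. a * c xs) \<in> boundary X ` chains X (i + 1)"
      by (intro image_eqI[of _ _ "\<lambda>xs. a * b xs"])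
        (simp_all add: boundary_linear(3) chain_space.subspace_scale[OF C])
  qed
qed

lemma chains_0_eq_0:
  assumes "c \<in> chains X 0" "\<And>v. v \<in> \<Union>X \<Longrightarrow> c [v] = 0"
  shows "c = (\<lambda>_. 0)"
proof
  fix xs show "c xs = 0"
  proof (rule ccontr)
    assume nz: "c xs \<noteq> 0"
    note s = chains_supp[OF assms(1) nz]
    then have "length xs = 1" by (simp add: face_dim_def distinct_card)
    then obtain v where "xs = [v]" by (auto simp: length_Suc_conv)
    then show False using s(2) nz assms(2)[of v] by auto
  qed
qed

text \<open>The ambient space of all functions on lists is infinite-dimensional. This bound keeps
  bases of cycle spaces finite, so that comparing their cardinalities is meaningful.\<close>

lemma chains_0_finite_dim:
  assumes "finite (\<Union>X)"
  obtains P :: "('a list \<Rightarrow> 'k::field) set" where "finite P" "chains X 0 \<subseteq> chain_space.span P"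
proof
  let ?\<delta> = "\<lambda>v xs. if xs = [v] then 1 else (0 :: 'k)"
  show "finite (?\<delta> ` \<Union>X)" using assms by simp
  show "chains X 0 \<subseteq> chain_space.span (?\<delta> ` \<Union>X)"
  proof
    fix c :: "'a list \<Rightarrow> 'k" assume c: "c \<in> chains X 0"
    have "c = (\<Sum>v\<in>\<Union>X. (\<lambda>xs. c [v] * ?\<delta> v xs))"
    proof
      fix xs
      have "c xs = (\<Sum>v\<in>\<Union>X. c [v] * ?\<delta> v xs)"
      proof (cases "c xs = 0")
        case True
        have "(\<Sum>v\<in>\<Union>X. c [v] * ?\<delta> v xs) = 0" using True by (intro sum.neutral) auto
        then show ?thesis using True by simp
      next
        case False
        note s = chains_supp[OF c False]
        then have "length xs = 1" by (simp add: face_dim_def distinct_card)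
        then obtain u where u: "xs = [u]" by (auto simp: length_Suc_conv)
        have "(\<Sum>v\<in>\<Union>X. c [v] * ?\<delta> v xs) = (\<Sum>v\<in>\<Union>X. if v = u then c [v] else 0)"
          unfolding u by (intro sum.cong) auto
        also have "\<dots> = c [u]" using assms s(2) u by auto
        finally show ?thesis using u by simp
      qed
      then show "c xs = (\<Sum>v\<in>\<Union>X. (\<lambda>xs. c [v] * ?\<delta> v xs)) xs" by (simp add: sum_fun_apply)
    qed
    also have "\<dots> \<in> chain_space.span (?\<delta> ` \<Union>X)"
      by (intro chain_space.span_sum chain_space.span_scale chain_space.span_base) simp
    finally show "c \<in> chain_space.span (?\<delta> ` \<Union>X)" .
  qed
qed

text \<open>The 0-cycle \<open>[x] - [y]\<close>, used as a test class: it detects separated vertex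
  sets, and two of them detect a third vertex.\<close>

definition point_difference :: "'a \<Rightarrow> 'a \<Rightarrow> 'a list \<Rightarrow> 'k::field" where
  "point_difference x y = (\<lambda>xs. if xs = [x] then 1 else if xs = [y] then -1 else 0)"

lemma point_difference_cycle:
  assumes sc: "simplicial_complex X" and xy: "x \<in> \<Union>X" "y \<in> \<Union>X" "x \<noteq> y"
  shows "(point_difference x y :: 'a list \<Rightarrow> 'k::field) \<in> cycles X 0"
proof -
  have v: "{x} \<in> X" "{y} \<in> X" using vertex_in_complex[OF sc] xy by blast+
  have "(point_difference x y :: 'a list \<Rightarrow> 'k) \<in> chains X 0"
  proof -
    \<comment> \<open>Singleton lists have no adjacent pair to exchange, so both sides of the sign
      rule are 0.\<close>
    have "us @ a # b # ws \<noteq> [u]" for us ws and a b u :: 'a by (cases us) simp_all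
    moreover have "xs = [x] \<or> xs = [y]" if "point_difference x y xs \<noteq> (0 :: 'k)" for xs
      using that by (auto simp: point_difference_def split: if_splits)
    ultimately show ?thesis
      using v unfolding chains_def by (fastforce simp: face_dim_def point_difference_def)
  qed
  moreover have "boundary X (point_difference x y :: 'a list \<Rightarrow> 'k) xs = 0" for xs
  \<comment> \<open>At the empty list the boundary is the augmentation, the sum of all coefficients;
    elsewhere it only sees lists of length at least two.\<close>
  proof (cases "xs = []")
    case True
    have "(\<Sum>v\<in>\<Union>X. point_difference x y [v] :: 'k)
        = (\<Sum>v\<in>\<Union>X. (if v = x then 1 else 0) - (if v = y then 1 else 0))"
      using xy(3) by (intro sum.cong) (auto simp: point_difference_def)
    also have "\<dots> = 0"
      using simplicial_complexD(5)[OF sc] xy by (simp only: sum_subtractf sum.delta') simp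
    finally show ?thesis using True by (simp add: boundary_def)
  qed (simp add: boundary_def point_difference_def)
  ultimately show ?thesis by (auto simp: cycles_def)
qed

text \<open>The sum of coefficients over \<open>S\<close> is a functional that kills boundaries when
  no edge leaves \<open>S\<close>: only pairs inside \<open>S\<close> remain, and they cancel by
  antisymmetry. The diagonal vanishes separately, so characteristic 2 is covered.\<close>

lemma sum_boundary_separated:
  assumes sc: "simplicial_complex X" and S: "S \<subseteq> \<Union>X"
    and sep: "\<And>x y. x \<in> S \<Longrightarrow> y \<in> \<Union>X - S \<Longrightarrow> {x, y} \<notin> X"
    and b: "b \<in> chains X 1"
  shows "(\<Sum>v\<in>S. boundary X b [v]) = 0"
proof -
  have finV: "finite (\<Union>X)" using simplicial_complexD(5)[OF sc] .
  have anti: "b [v, w] = - b [w, v]" for v w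
    using chains_swap[OF b, of "[]" v w "[]"] by simp
  have diag: "b [v, v] = 0" for v using chains_supp(1)[OF b, of "[v, v]"] by fastforce
  have "(\<Sum>w\<in>\<Union>X. b [w, v]) = (\<Sum>w\<in>S. b [w, v])" if "v \<in> S" for v
  proof (rule sum.mono_neutral_right[OF finV S])
    show "\<forall>w\<in>\<Union>X - S. b [w, v] = 0"
      using chains_supp(2)[OF b] sep[OF that] by (metis insert_commute list.simps(15) list.set(1))
  qed
  then have "(\<Sum>v\<in>S. boundary X b [v]) = (\<Sum>v\<in>S. \<Sum>w\<in>S. b [w, v])"
    by (simp add: boundary_def)
  also have "\<dots> = 0"
    using finite_subset[OF S finV]
  proof (induction rule: finite_induct)
    case (insert a V)
    have "(\<Sum>v\<in>V. b [a, v]) = - (\<Sum>v\<in>V. b [v, a])"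
      unfolding sum_negf[symmetric] by (rule sum.cong[OF refl]) (rule anti)
    then show ?case using insert by (simp add: sum.distrib diag)
  qed simp
  finally show ?thesis .
qed

text \<open>Across a cut without edges, \<open>[x] - [y]\<close> has coefficient sum 1 over
  \<open>S\<close> and is not a boundary. Added to a basis of the boundaries it stays independent
  among the cycles, so the two dimensions differ.\<close>

lemma cut_connected_of_reduced_betti_0:
  assumes sc: "simplicial_complex X" and betti: "reduced_betti TYPE('k::field) X 0 = 0"
  shows "cut_connected X"
  unfolding cut_connected_def
proof (intro allI impI, rule ccontr)
  fix S assume S: "S \<subseteq> \<Union>X" "S \<noteq> {}" "S \<noteq> \<Union>X"
    and no: "\<not> (\<exists>x\<in>S. \<exists>y\<in>\<Union>X - S. {x, y} \<in> X)"
  have finV: "finite (\<Union>X)" using simplicial_complexD(5)[OF sc] .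
  obtain x y where xy: "x \<in> S" "y \<in> \<Union>X" "y \<notin> S" using S by blast
  define c :: "'a list \<Rightarrow> 'k" where "c = point_difference x y"
  have c: "c \<in> cycles X 0"
    unfolding c_def using xy S(1) by (intro point_difference_cycle[OF sc]) auto
  have c_notin: "c \<notin> boundaries X 0"
  proof
    assume "c \<in> boundaries X 0"
    then obtain b where b: "b \<in> chains X 1" "c = boundary X b" by (auto simp: boundaries_def)
    have "(\<Sum>v\<in>S. c [v]) = (\<Sum>v\<in>S. if v = x then 1 else 0)"
      using xy by (intro sum.cong) (auto simp: c_def point_difference_def)
    also have "\<dots> = 1" using xy(1) finite_subset[OF S(1) finV] by simp
    finally show False using sum_boundary_separated[OF sc S(1) _ b(1)] no b(2) by auto
  qed
  obtain B :: "('a list \<Rightarrow> 'k) set" where B: "B \<subseteq> boundaries X 0" "chain_space.independent B"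
      "boundaries X 0 \<subseteq> chain_space.span B" "card B = chain_space.dim (boundaries X 0 :: ('a list \<Rightarrow> 'k) set)"
    using chain_space.basis_exists by blast
  have "chain_space.span B \<subseteq> boundaries X 0"
    using chain_space.span_minimal[OF B(1) subspace_boundaries] .
  then have c_span: "c \<notin> chain_space.span B" using c_notin by blast
  then have ind: "chain_space.independent (insert c B)"
    using B(2) by (rule chain_space.independent_insertI)
  have "insert c B \<subseteq> cycles X 0" using c B(1) boundaries_subset_cycles[OF sc] by blast
  then obtain B' :: "('a list \<Rightarrow> 'k) set" where B': "insert c B \<subseteq> B'" "B' \<subseteq> cycles X 0"
      "chain_space.independent B'" "cycles X 0 \<subseteq> chain_space.span B'"
    using chain_space.maximal_independent_subset_extend[OF _ ind] by metis
  obtain P :: "('a list \<Rightarrow> 'k) set" where P: "finite P" "chains X 0 \<subseteq> chain_space.span P"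
    using chains_0_finite_dim[OF finV] .
  have "B' \<subseteq> chain_space.span P" using B'(2) P(2) unfolding cycles_def by blast
  then have finB': "finite B'" using chain_space.independent_span_bound[OF P(1) B'(3)] by blast
  have "c \<notin> B" using c_span chain_space.span_base by blast
  then have "card (insert c B) = Suc (card B)"
    using finB' B'(1) by (intro card_insert_disjoint) (auto intro: finite_subset)
  moreover have "card (insert c B) \<le> card B'" using finB' B'(1) by (rule card_mono)
  moreover have "card B' = chain_space.dim (cycles X 0 :: ('a list \<Rightarrow> 'k) set)"
    using chain_space.basis_card_eq_dim[OF B'(2,4,3)] .
  \<comment> \<open>With truncated subtraction, Betti number 0 means only that the cycles have at
    most the dimension of the boundaries; \<open>B'\<close> refutes even this.\<close>
  ultimately show False using betti B(4) by (simp add: reduced_betti_def)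
qed

text \<open>Without edges the boundaries vanish, so the cycles form a line spanned by
  \<open>b\<close>. At most one vertex leaves no nonzero chain of augmentation 0; three vertices
  give two independent point differences.\<close>

lemma card_vertices_of_reduced_betti_1:
  assumes sc: "simplicial_complex X" and no_edges: "\<And>\<sigma>. \<sigma> \<in> X \<Longrightarrow> card \<sigma> \<le> 1"
    and betti: "reduced_betti TYPE('k::field) X 0 = 1"
  shows "card (\<Union>X) = 2"
proof -
  have finV: "finite (\<Union>X)" using simplicial_complexD(5)[OF sc] .
  have "c = 0" if c: "c \<in> chains X 1" for c :: "'a list \<Rightarrow> 'k"
  proof
    fix xs show "c xs = 0 xs"
      using chains_supp(2,3)[OF c, of xs] no_edges[of "set xs"] by (fastforce simp: face_dim_def)
  qed
  then have "boundaries X 0 \<subseteq> {0 :: 'a list \<Rightarrow> 'k}"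
    using boundary_linear(1) by (fastforce simp: boundaries_def)
  then have "boundaries X 0 \<subseteq> chain_space.span ({} :: ('a list \<Rightarrow> 'k) set)"
    by (simp add: chain_space.span_empty)
  then have "chain_space.dim (boundaries X 0 :: ('a list \<Rightarrow> 'k) set) \<le> 0"
    using chain_space.dim_le_card[of "boundaries X 0" "{} :: ('a list \<Rightarrow> 'k) set"] by simp
  then have "chain_space.dim (cycles X 0 :: ('a list \<Rightarrow> 'k) set) = 1"
    using betti by (simp add: reduced_betti_def)
  then obtain B :: "('a list \<Rightarrow> 'k) set" where B: "B \<subseteq> cycles X 0" "chain_space.independent B"
      "cycles X 0 \<subseteq> chain_space.span B" "card B = 1"
    using chain_space.basis_exists by metis
  then obtain b where b: "B = {b}" using card_1_singletonE by blast
  have mult: "\<exists>a. c = (\<lambda>xs. a * b xs)" if "c \<in> cycles X 0" for c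
    using that B(3) unfolding b chain_space.span_singleton by blast
  have b_nz: "b \<noteq> (\<lambda>_. 0)"
    using B(2) chain_space.dependent_zero[of B] unfolding b zero_fun_def by blast
  have bc: "b \<in> chains X 0" "boundary X b [] = 0" using B(1) b by (auto simp: cycles_def)
  have "\<not> card (\<Union>X) \<le> 1"
  proof
    assume le: "card (\<Union>X) \<le> 1"
    have "b [v] = 0" if "v \<in> \<Union>X" for v
    proof -
      have "{v} = \<Union>X" using that le finV by (intro card_seteq) auto
      then show ?thesis using bc(2) unfolding boundary_def by (metis sum.insert sum.empty finite.emptyI empty_iff add_0_right)
    qed
    then show False using chains_0_eq_0[OF bc(1)] b_nz by blast
  qed
  moreover have "\<not> 3 \<le> card (\<Union>X)"
  proof
    assume "3 \<le> card (\<Union>X)"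
    then obtain T where "T \<subseteq> \<Union>X" "card T = 3" using obtain_subset_with_card_n by metis
    moreover obtain x y z where "T = {x, y, z}" "x \<noteq> y" "y \<noteq> z" "x \<noteq> z"
      using \<open>card T = 3\<close> by (auto simp: card_3_iff)
    ultimately have xyz: "x \<in> \<Union>X" "y \<in> \<Union>X" "z \<in> \<Union>X" "x \<noteq> y" "x \<noteq> z" "y \<noteq> z"
      by blast+
    obtain \<alpha> where \<alpha>: "point_difference x y = (\<lambda>xs. \<alpha> * b xs)"
      using mult point_difference_cycle[OF sc xyz(1,2,4)] by blast
    obtain \<beta> where \<beta>: "point_difference x z = (\<lambda>xs. \<beta> * b xs)"
      using mult point_difference_cycle[OF sc xyz(1,3,5)] by blast
    \<comment> \<open>The first equation makes \<open>b [y]\<close> nonzero, so the second forces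
      \<open>\<beta> = 0\<close>, against the third.\<close>
    have "\<alpha> * b [y] = -1" "\<beta> * b [y] = 0" "\<beta> * b [z] = -1"
      using fun_cong[OF \<alpha>, of "[y]"] fun_cong[OF \<beta>, of "[y]"] fun_cong[OF \<beta>, of "[z]"] xyz
      by (simp_all add: point_difference_def)
    then show False by auto
  qed
  ultimately show ?thesis by linarith
qed

text \<open>The link of a nonempty \<open>\<sigma>\<close> is a homology sphere of dimension
  \<open>D - card \<sigma> - 1\<close>: its Betti number in degree 0 is 1 for ridges, giving two
  points, and 0 for smaller faces, giving connectedness. The empty face is outside the manifold
  condition, and \<open>conn\<close> supplies that case.\<close>

lemma normal_pseudomanifold_of_homology_manifold:
  assumes M: "homology_manifold TYPE('k::field) X" and conn: "connected_complex X"
    and pure: "\<And>\<sigma>. \<sigma> \<in> X \<Longrightarrow> card \<sigma> \<le> D \<and> (\<exists>\<tau>\<in>X. \<sigma> \<subseteq> \<tau> \<and> card \<tau> = D)"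
    and D: "2 \<le> D"
  shows "normal_pseudomanifold D X"
proof -
  have sc: "simplicial_complex X" using M by (simp add: homology_manifold_def)
  note C = simplicial_complexD[OF sc]
  have dim: "complex_dim X = int D - 1"
    unfolding complex_dim_def
  proof (rule Max_eqI)
    show "int D - 1 \<in> face_dim ` X" using pure[OF C(2)] by (force simp: face_dim_def)
    show "\<And>y. y \<in> face_dim ` X \<Longrightarrow> y \<le> int D - 1" using pure by (fastforce simp: face_dim_def)
  qed (use C(1) in simp)
  have betti: "reduced_betti TYPE('k) (link X \<sigma>) 0 = (if card \<sigma> + 1 = D then 1 else 0)"
    if "\<sigma> \<in> X" "\<sigma> \<noteq> {}" for \<sigma>
  proof -
    have "has_homology_of_sphere TYPE('k) (link X \<sigma>) (complex_dim X - face_dim \<sigma> - 1)"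
      using M that unfolding homology_manifold_def by blast
    then have "reduced_betti TYPE('k) (link X \<sigma>) 0
        = (if 0 = complex_dim X - face_dim \<sigma> - 1 then 1 else 0)"
      unfolding has_homology_of_sphere_def by blast
    moreover have "0 = complex_dim X - face_dim \<sigma> - 1 \<longleftrightarrow> card \<sigma> + 1 = D"
      unfolding dim face_dim_def by linarith
    ultimately show ?thesis by simp
  qed
  have "cut_connected (link X \<sigma>)" if \<sigma>: "\<sigma> \<in> X" "card \<sigma> + 2 \<le> D" for \<sigma>
  proof (cases "\<sigma> = {}")
    case True
    then show ?thesis using cut_connected_of_connected_complex[OF conn] by simp
  next
    case False
    then show ?thesis
      using cut_connected_of_reduced_betti_0[OF simplicial_complex_link[OF sc \<sigma>(1)]]
        betti[OF \<sigma>(1) False] \<sigma>(2) by simp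
  qed
  moreover have "card (\<Union>(link X \<sigma>)) = 2" if \<sigma>: "\<sigma> \<in> X" "card \<sigma> + 1 = D" for \<sigma>
  proof (rule card_vertices_of_reduced_betti_1[OF simplicial_complex_link[OF sc \<sigma>(1)]])
    \<comment> \<open>\<open>2 \<le> D\<close> makes a ridge nonempty, so the manifold condition
      applies to it.\<close>
    have "\<sigma> \<noteq> {}" using \<sigma>(2) D by auto
    then show "reduced_betti TYPE('k) (link X \<sigma>) 0 = 1" using betti \<sigma> by simp
    show "card \<tau> \<le> 1" if "\<tau> \<in> link X \<sigma>" for \<tau>
      using card_link_face[OF sc \<sigma>(1) that] pure[of "\<sigma> \<union> \<tau>"] \<sigma>(2) by simp
  qed
  ultimately show ?thesis using sc pure unfolding normal_pseudomanifold_def by blast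
qed

section \<open>Summation over edge links\<close>

lemma pure_complex_card:
  assumes sc: "simplicial_complex X" and pure: "pure_complex X"
    and dim: "complex_dim X = int D - 1" and \<sigma>: "\<sigma> \<in> X"
  shows "card \<sigma> \<le> D \<and> (\<exists>\<tau>\<in>X. \<sigma> \<subseteq> \<tau> \<and> card \<tau> = D)"
proof
  have "face_dim \<sigma> \<le> complex_dim X"
    unfolding complex_dim_def using simplicial_complexD(1)[OF sc] \<sigma> by (intro Max_ge) auto
  then show "card \<sigma> \<le> D" using dim by (simp add: face_dim_def)
  obtain \<tau> where \<tau>: "\<tau> \<in> X" "\<sigma> \<subseteq> \<tau>" and max: "\<forall>\<rho>\<in>X. \<tau> \<subseteq> \<rho> \<longrightarrow> \<rho> = \<tau>"
    using finite_has_maximal2[OF simplicial_complexD(1)[OF sc] \<sigma>] by auto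
  have "face_dim \<tau> = complex_dim X"
    using pure \<tau>(1) max unfolding pure_complex_def by blast
  then have "card \<tau> = D" using dim by (simp add: face_dim_def)
  then show "\<exists>\<tau>\<in>X. \<sigma> \<subseteq> \<tau> \<and> card \<tau> = D" using \<tau> by blast
qed

text \<open>Both sides count pairs of an edge inside a face with \<open>k + 2\<close> vertices;
  removing the edge gives the face of the link.\<close>

lemma sum_card_faces_of_edge_links:
  assumes sc: "simplicial_complex X"
  shows "(\<Sum>e\<in>edges X. card {\<tau>\<in>link X e. card \<tau> = k})
    = ((k + 2) choose 2) * card {\<sigma>\<in>X. card \<sigma> = k + 2}"
proof -
  note C = simplicial_complexD[OF sc]
  have "card {\<tau>\<in>link X e. card \<tau> = k} = card {\<sigma>\<in>{\<sigma>\<in>X. card \<sigma> = k + 2}. e \<subseteq> \<sigma>}"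
    if "e \<in> edges X" for e
  proof (rule bij_betw_same_card[OF bij_betw_byWitness[where f = "\<lambda>\<tau>. \<tau> \<union> e" and f' = "\<lambda>\<sigma>. \<sigma> - e"]])
    have e: "e \<in> X" "card e = 2" using that by (auto simp: edges_def)
    show "\<forall>\<tau>\<in>{\<tau>\<in>link X e. card \<tau> = k}. \<tau> \<union> e - e = \<tau>" by (auto simp: link_def)
    show "\<forall>\<sigma>\<in>{\<sigma>\<in>{\<sigma>\<in>X. card \<sigma> = k + 2}. e \<subseteq> \<sigma>}. \<sigma> - e \<union> e = \<sigma>" by blast
    show "(\<lambda>\<tau>. \<tau> \<union> e) ` {\<tau>\<in>link X e. card \<tau> = k} \<subseteq> {\<sigma>\<in>{\<sigma>\<in>X. card \<sigma> = k + 2}. e \<subseteq> \<sigma>}"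
      using card_link_face[OF sc e(1)] e(2) by (auto simp: Un_commute)
    show "(\<lambda>\<sigma>. \<sigma> - e) ` {\<sigma>\<in>{\<sigma>\<in>X. card \<sigma> = k + 2}. e \<subseteq> \<sigma>} \<subseteq> {\<tau>\<in>link X e. card \<tau> = k}"
      using e C(3)[OF e(1)] by (auto simp: link_def card_Diff_subset Un_absorb2)
  qed
  then have "(\<Sum>e\<in>edges X. card {\<tau>\<in>link X e. card \<tau> = k})
      = (\<Sum>e\<in>edges X. card {\<sigma>\<in>{\<sigma>\<in>X. card \<sigma> = k + 2}. e \<subseteq> \<sigma>})" by simp
  also have "\<dots> = (\<Sum>\<sigma>\<in>{\<sigma>\<in>X. card \<sigma> = k + 2}. (k + 2) choose 2)"
  proof (rule sum_multicount_gen)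
    show "\<forall>\<sigma>\<in>{\<sigma>\<in>X. card \<sigma> = k + 2}. card {e\<in>edges X. e \<subseteq> \<sigma>} = (k + 2) choose 2"
    proof
      fix \<sigma> assume \<sigma>: "\<sigma> \<in> {\<sigma>\<in>X. card \<sigma> = k + 2}"
      then have "{e\<in>edges X. e \<subseteq> \<sigma>} = {e. e \<subseteq> \<sigma> \<and> card e = 2}" using C(4) by (auto simp: edges_def)
      then show "card {e\<in>edges X. e \<subseteq> \<sigma>} = (k + 2) choose 2"
        using n_subsets[of \<sigma> 2] C(3) \<sigma> by auto
    qed
  qed (use C(1) in \<open>auto simp: edges_def\<close>)
  finally show ?thesis by (simp add: mult.commute)
qed

section \<open>From face counts to h-numbers\<close>

lemma card_vertices:
  assumes "simplicial_complex X"
  shows "card (\<Union>X) = card {\<sigma>\<in>X. card \<sigma> = 1}"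
proof -
  have "{\<sigma>\<in>X. card \<sigma> = 1} = (\<lambda>v. {v}) ` \<Union>X"
    using vertex_in_complex[OF assms] by (auto simp: card_1_singleton_iff)
  then show ?thesis by (simp add: card_image)
qed

text \<open>Binomial symmetry replaces the lower index \<open>d - i\<close> by \<open>i - j\<close>,
  which is a numeral for \<open>i \<le> 4\<close>, so the sums can be expanded with \<open>d\<close>
  left symbolic.\<close>

lemma h_num_eq:
  assumes "i \<le> d"
  shows "h_num d X i
    = (\<Sum>j=0..i. (-1) ^ (i - j) * int ((d - j) choose (i - j)) * int (card {\<sigma>\<in>X. card \<sigma> = j}))"
  unfolding h_num_def
proof (rule sum.cong)
  fix j assume j: "j \<in> {0..i}"
  have "(d - j) choose (d - i) = (d - j) choose (i - j)"
    using j assms binomial_symmetric[of "d - i" "d - j"] by simp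
  moreover have "f_num X (int j - 1) = card {\<sigma>\<in>X. card \<sigma> = j}"
    by (simp add: f_num_def face_dim_def)
  ultimately show "(-1) ^ (i - j) * int ((d - j) choose (d - i)) * int (f_num X (int j - 1))
      = (-1) ^ (i - j) * int ((d - j) choose (i - j)) * int (card {\<sigma>\<in>X. card \<sigma> = j})" by simp
qed simp

text \<open>Denominators are cleared and the factors are integers, so no lower bound on
  \<open>n\<close> is required: for small \<open>n\<close> a factor is 0.\<close>

lemma binomial_2_3_4:
  "2 * int (n choose 2) = int n * (int n - 1)"
  "6 * int (n choose 3) = int n * (int n - 1) * (int n - 2)"
  "24 * int (n choose 4) = int n * (int n - 1) * (int n - 2) * (int n - 3)"
proof -
  show 2: "2 * int (n choose 2) = int n * (int n - 1)" for n
    by (induction n) (simp_all add: eval_nat_numeral algebra_simps)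
  show 3: "6 * int (n choose 3) = int n * (int n - 1) * (int n - 2)" for n
  proof (induction n)
    case (Suc n)
    have "Suc n choose 3 = (n choose 2) + (n choose 3)" by (simp add: eval_nat_numeral)
    then have "6 * int (Suc n choose 3) = 3 * (2 * int (n choose 2)) + 6 * int (n choose 3)" by simp
    then show ?case unfolding 2 Suc.IH by (simp add: algebra_simps)
  qed simp
  show "24 * int (n choose 4) = int n * (int n - 1) * (int n - 2) * (int n - 3)"
  proof (induction n)
    case (Suc n)
    have "Suc n choose 4 = (n choose 3) + (n choose 4)" by (simp add: eval_nat_numeral)
    then have "24 * int (Suc n choose 4) = 4 * (6 * int (n choose 3)) + 24 * int (n choose 4)" by simp
    then show ?case unfolding 3 Suc.IH by (simp add: algebra_simps)
  qed simp
qed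

theorem theorem4p11:
  fixes \<Delta> :: "'a set set" and d :: nat
  assumes "simplicial_complex \<Delta>"
    and "connected_complex \<Delta>"
    and "pure_complex \<Delta>"
    and "complex_dim \<Delta> = int d - 1"
    and "d \<ge> 5"
    and "\<And>e. e \<in> \<Delta> \<Longrightarrow> face_dim e = 1 \<Longrightarrow>
           homology_manifold TYPE('k::field) (link \<Delta> e) \<and> connected_complex (link \<Delta> e)"
  shows "12 * h_num d \<Delta> 4 + 6 * (int d - 4) * h_num d \<Delta> 3
           + (int d - 2) * (int d - 7) * h_num d \<Delta> 2
           - (int d - 1) * (int d - 2) * h_num d \<Delta> 1 \<ge> 0"
proof -
  note sc = assms(1)
  note pure = pure_complex_card[OF sc assms(3,4)]
  let ?f = "\<lambda>k. card {\<sigma>\<in>\<Delta>. card \<sigma> = k}"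
  have link_bound: "(d - 2) * card {\<tau>\<in>link \<Delta> e. card \<tau> = 1}
      \<le> card {\<tau>\<in>link \<Delta> e. card \<tau> = 2} + (d - 1 choose 2)"
    if "e \<in> edges \<Delta>" for e
  proof -
    have e: "e \<in> \<Delta>" "card e = 2" using that by (auto simp: edges_def)
    have "normal_pseudomanifold (d - 2) (link \<Delta> e)"
    proof (rule normal_pseudomanifold_of_homology_manifold[where 'k = 'k])
      show "homology_manifold TYPE('k) (link \<Delta> e)" "connected_complex (link \<Delta> e)"
        using assms(6)[OF e(1)] e(2) by (auto simp: face_dim_def)
      show "card \<sigma> \<le> d - 2 \<and> (\<exists>\<tau>\<in>link \<Delta> e. \<sigma> \<subseteq> \<tau> \<and> card \<tau> = d - 2)" if "\<sigma> \<in> link \<Delta> e" for \<sigma>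
        using pure_link[OF sc pure e(1) that] e(2) by simp
    qed (use assms(5) in simp)
    from lower_bound_normal_pseudomanifold[OF this] assms(5)
    show ?thesis
      unfolding card_vertices[OF simplicial_complex_link[OF sc e(1)]]
      by (simp add: edges_def Suc_diff_Suc numeral_2_eq_2)
  qed
  have "(d - 2) * (\<Sum>e\<in>edges \<Delta>. card {\<tau>\<in>link \<Delta> e. card \<tau> = 1})
      \<le> (\<Sum>e\<in>edges \<Delta>. card {\<tau>\<in>link \<Delta> e. card \<tau> = 2} + (d - 1 choose 2))"
    unfolding sum_distrib_left by (rule sum_mono) (rule link_bound)
  \<comment> \<open>The factors 3 and 6 are \<open>3 choose 2\<close> and \<open>4 choose 2\<close>;
    \<open>?f 2\<close> is the number of edge links, each contributing the constant
    \<open>d - 1 choose 2\<close>.\<close>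
  then have "(d - 2) * (3 * ?f 3) \<le> 6 * ?f 4 + ?f 2 * (d - 1 choose 2)"
    unfolding sum.distrib sum_card_faces_of_edge_links[OF sc]
    by (simp add: edges_def eval_nat_numeral)
  then have "int ((d - 2) * (3 * ?f 3)) \<le> int (6 * ?f 4 + ?f 2 * (d - 1 choose 2))"
    by (rule of_nat_mono)
  then have ineq: "(int d - 2) * (3 * int (?f 3)) \<le> 6 * int (?f 4) + int (?f 2) * int (d - 1 choose 2)"
    using assms(5) by (simp add: of_nat_diff)
  have "{\<sigma>\<in>\<Delta>. card \<sigma> = 0} = {{}}"
    using simplicial_complexD(2,3)[OF sc] by auto
  then have f0: "?f 0 = 1" by simp
  have h: "h_num d \<Delta> 1 = int (?f 1) - int d"
    "h_num d \<Delta> 2 = int (?f 2) - (int d - 1) * int (?f 1) + int (d choose 2)"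
    "h_num d \<Delta> 3 = int (?f 3) - (int d - 2) * int (?f 2) + int (d - 1 choose 2) * int (?f 1)
      - int (d choose 3)"
    "h_num d \<Delta> 4 = int (?f 4) - (int d - 3) * int (?f 3) + int (d - 2 choose 2) * int (?f 2)
      - int (d - 1 choose 3) * int (?f 1) + int (d choose 4)"
    using assms(5) f0 by (simp_all add: h_num_eq numeral_eq_Suc of_nat_diff left_diff_distrib)
  have d: "int (d - 1) = int d - 1" "int (d - 2) = int d - 2" using assms(5) by (simp_all add: of_nat_diff)
  note binom = binomial_2_3_4[of d] binomial_2_3_4[of "d - 1", unfolded d]
    binomial_2_3_4[of "d - 2", unfolded d]
  \<comment> \<open>The multiples 2, 6 and 24 turn the binomials into polynomials in
    \<open>d\<close>.\<close>
  have h2: "2 * h_num d \<Delta> 2 = 2 * int (?f 2) - 2 * (int d - 1) * int (?f 1) + int d * (int d - 1)"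
    unfolding h using binom by simp
  have h3: "6 * h_num d \<Delta> 3 = 6 * int (?f 3) - 6 * (int d - 2) * int (?f 2)
      + 3 * ((int d - 1) * (int d - 2)) * int (?f 1) - int d * (int d - 1) * (int d - 2)"
  proof -
    have "6 * h_num d \<Delta> 3 = 6 * int (?f 3) - 6 * (int d - 2) * int (?f 2)
      + 3 * (2 * int (d - 1 choose 2)) * int (?f 1) - 6 * int (d choose 3)"
      unfolding h by (simp add: algebra_simps)
    then show ?thesis unfolding binom by (simp add: algebra_simps)
  qed
  have h4: "24 * h_num d \<Delta> 4 = 24 * int (?f 4) - 24 * (int d - 3) * int (?f 3)
      + 12 * ((int d - 2) * (int d - 3)) * int (?f 2)
      - 4 * ((int d - 1) * (int d - 2) * (int d - 3)) * int (?f 1)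
      + int d * (int d - 1) * (int d - 2) * (int d - 3)"
  proof -
    have "24 * h_num d \<Delta> 4 = 24 * int (?f 4) - 24 * (int d - 3) * int (?f 3)
      + 12 * (2 * int (d - 2 choose 2)) * int (?f 2)
      - 4 * (6 * int (d - 1 choose 3)) * int (?f 1) + 24 * int (d choose 4)"
      unfolding h by (simp add: algebra_simps)
    then show ?thesis unfolding binom by (simp add: algebra_simps)
  qed
  let ?L = "12 * h_num d \<Delta> 4 + 6 * (int d - 4) * h_num d \<Delta> 3
           + (int d - 2) * (int d - 7) * h_num d \<Delta> 2 - (int d - 1) * (int d - 2) * h_num d \<Delta> 1"
  have "2 * ?L = 24 * h_num d \<Delta> 4 + 2 * (int d - 4) * (6 * h_num d \<Delta> 3)
      + (int d - 2) * (int d - 7) * (2 * h_num d \<Delta> 2)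
      - 2 * (int d - 1) * (int d - 2) * h_num d \<Delta> 1"
    by (simp add: algebra_simps)
  \<comment> \<open>The weights of the h-numbers are such that the vertex count and the constant
    terms cancel, leaving only \<open>?f 2\<close>, \<open>?f 3\<close> and \<open>?f 4\<close>, as
    in \<open>ineq\<close>.\<close>
  also have "\<dots> = 4 * (6 * int (?f 4) - (int d - 2) * (3 * int (?f 3)))
      + 2 * int (?f 2) * ((int d - 1) * (int d - 2))"
    unfolding h2 h3 h4 h(1) by (simp add: algebra_simps)
  also have "\<dots> = 4 * (6 * int (?f 4) + int (?f 2) * int (d - 1 choose 2) - (int d - 2) * (3 * int (?f 3)))"
  proof -
    have "(int d - 1) * (int d - 2) = 2 * int (d - 1 choose 2)" using binom by simp
    then show ?thesis by (simp add: algebra_simps)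
  qed
  also have "0 \<le> \<dots>" using ineq by simp
  finally have "0 \<le> 2 * ?L" .
  then show ?thesis unfolding zero_le_mult_iff by simp
qed

end
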